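(* Let $T=(N,E)$ be a directed tree with root $0$, $|N|\ge3$, and set of leaves $L$. Let $P=\{\ell_1,\ell_2,\ldots\}\subseteq N\setminus\{0\}$ with $(0,\ell_1),(\ell_1,\ell_2),\ldots\in E$ be a path of nodes that starts with a child of the root and either terminates at a leaf or has infinitely many nodes, and let $k^*$ be a child of the root with $k^*\notin P$ whenever $\deg(0)\ge2$. For sequences $X=(X_n)_{n\in N}$, $Y=(Y_n)_{n\in N}$ and a node $j^*\in N\setminus\{0\}$ with parent $p_{j^*}$, consider the following conditions on an edge $(i,j)\in E$: (i) $X_j\uparrow_{st}X_i$ if $j\ne k^*$; (ii) $Y_i\uparrow_{st}Y_j$ if $j\notin L$, and $Y_j\uparrow_{st}Y_i$ if $j\notin P$; (iii) $(X_i,X_j)\leq_{sm}(Y_i,Y_j)$; ($i^*$) $X_j\uparrow_{st}X_i$ if $j\notin\{k^*,j^*\}$, and $(X_{p_{j^*}}^\perp,X_{j^*}^\perp)\leq_{sm}(X_{p_{j^*}},X_{j^*})$; ($ii^*$) $Y_i\uparrow_{st}Y_j$ if $j\notin L\cup\{j^*\}$, $Y_j\uparrow_{st}Y_i$ if $j\notin P$, and $(X_{p_{j^*}}^\perp,X_{j^*}^\perp)\leq_{sm}(X_{p_{j^*}},X_{j^*})$; ($ii^{**}$) $Y_i\uparrow_{st}Y_j$ if $j\notin L$, $Y_j\uparrow_{st}Y_i$ if $j\notin P\cup\{j^*\}$, and $(X_{p_{j^*}}^\perp,X_{j^*}^\perp)\leq_{sm}(X_{p_{j^*}},X_{j^*})$.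 Then: (a) For any $j^*\in N\setminus\{0,k^*\}$ there are sequences $X$ and $Y$, each Markov tree distributed with respect to $T$, with $X\not\leq_{lo}Y$, such that ($i^*$), (ii) and (iii) hold for all $(i,j)\in E$. (b) If $T$ is not a star, then for any $j^*\in N\setminus(L\cup\{0\})$ there are sequences $X$ and $Y$, each Markov tree distributed with respect to $T$, with $X\not\leq_{lo}Y$, such that (i), ($ii^*$) and (iii) hold for all $(i,j)\in E$. (c) If $T$ is not a chain, then for any $j^*\in N\setminus(P\cup\{0\})$ there are sequences $X$ and $Y$, each Markov tree distributed with respect to $T$, with $X\not\leq_{lo}Y$, such that (i), ($ii^{**}$) and (iii) hold for all $(i,j)\in E$. In particular, in each of (a)–(c), $X\not\leq_{sm}Y$.
   Context: Trees. $N=\{0,1,\dots,d\}$ with $d\in\mathbb N$, or $N=\mathbb N_0$. A (directed) tree $T=(N,E)$ with root $0$ has oriented edges $E\subset N\times N$ such that for every $i\in N\setminus\{0\}$ there is a unique directed path from $0$ to $i$. $\deg(i)$ is the (possibly infinite) number of $j$ with $(i,j)\in E$ or $(j,i)\in E$; $L=\{k\in N\setminus\{0\}:\deg(k)=1\}$ is the set of leaves. If $(i,j)\in E$, then $j$ is a child of $i$ and $i=p_j$ is the parent of $j$. $T$ is a star if $L=N\setminus\{0\}$; $T$ is a chain if it is a single directed path starting at the root (equivalently, $P\cup\{0\}=N$). Between any two nodes there is a unique undirected path; the path between $i$ and $j$ is the set of nodes strictly between them. Markov tree dependence. A node $i$ separates disjoint $A,B\subset N$ if for all $a\in A$, $b\in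 B$ the path between $a$ and $b$ contains $i$. $(X_n)_{n\in N}$ is Markov tree distributed with respect to $T$ if for all finite disjoint $A,B\subset N$ and every $i$ separating $A$ and $B$, $(X_j)_{j\in A}$ and $(X_j)_{j\in B}$ are conditionally independent given $X_i$. Notation. "Increasing" means non-decreasing. $V\uparrow_{st}U$ means that $\mathbb E[f(V)\mid U=u]$ is increasing in $u$ outside a $P^U$-null set, for all increasing $f$ such that the expectations exist. $(U^\perp,V^\perp)$ denotes a random vector with independent components with the same marginals as $(U,V)$. $V\leq_{lo}W$ means $F_V(x)\le F_W(x)$ for all $x$ (joint distribution functions); $V\leq_{sm}W$ means $\mathbb Ef(V)\le\mathbb Ef(W)$ for all measurable supermodular $f$ that are $b$-bounded ($\sup|f|/b<\infty$ for a fixed measurable weight function $b\ge1$ for which the vectors are $b$-integrable), where $f$ is supermodular if $f(x)+f(y)\le f(x\wedge y)+f(x\vee y)$ for all $x,y$. For infinite sequences, the orders mean that all finite-dimensional subvectors are so ordered. *)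

theory Defs
  imports "HOL-Probability.Probability" "HOL-Library.Extended_Nat"
begin

section \<open>Directed trees\<close>

definition ecard :: "'a set \<Rightarrow> enat" where
  "ecard A = (if finite A then enat (card A) else \<infinity>)"

definition is_node_set :: "nat set \<Rightarrow> bool" where
  "is_node_set N \<longleftrightarrow> (\<exists>d\<ge>1. N = {0..d}) \<or> N = UNIV"

text \<open>Repeated nodes are allowed here: uniqueness of walks from the root is what rules out
  loops, directed cycles and edges pointing back to the root (uniqueness of simple paths would
  not).\<close>

definition directed_walk :: "(nat \<times> nat) set \<Rightarrow> nat \<Rightarrow> nat \<Rightarrow> nat list \<Rightarrow> bool" where
  "directed_walk E a b p \<longleftrightarrow>
     p \<noteq> [] \<and> hd p = a \<and> last p = b \<and> successively (\<lambda>x y. (x, y) \<in> E) p"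

definition directed_tree :: "nat set \<Rightarrow> (nat \<times> nat) set \<Rightarrow> bool" where
  "directed_tree N E \<longleftrightarrow>
     is_node_set N \<and> E \<subseteq> N \<times> N \<and> (\<forall>i\<in>N - {0}. \<exists>!p. directed_walk E 0 i p)"

definition deg :: "(nat \<times> nat) set \<Rightarrow> nat \<Rightarrow> enat" where
  "deg E i = ecard {j. (i, j) \<in> E \<or> (j, i) \<in> E}"

definition leaves :: "nat set \<Rightarrow> (nat \<times> nat) set \<Rightarrow> nat set" where
  "leaves N E = {k \<in> N - {0}. deg E k = 1}"

definition parent :: "(nat \<times> nat) set \<Rightarrow> nat \<Rightarrow> nat" where
  "parent E j = (THE i. (i, j) \<in> E)"

definition is_star :: "nat set \<Rightarrow> (nat \<times> nat) set \<Rightarrow> bool" where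
  "is_star N E \<longleftrightarrow> leaves N E = N - {0}"

text \<open>A directed path from the root with \<open>n \<le> \<infinity>\<close> edges is given by its nodes
  \<open>l 0, l 1, \<dots>\<close>; the values of \<open>l\<close> beyond \<open>n\<close> are irrelevant.\<close>

definition path_from_root :: "(nat \<times> nat) set \<Rightarrow> enat \<Rightarrow> (nat \<Rightarrow> nat) \<Rightarrow> bool" where
  "path_from_root E n l \<longleftrightarrow> l 0 = 0 \<and> (\<forall>k. enat k < n \<longrightarrow> (l k, l (Suc k)) \<in> E)"

definition is_chain :: "nat set \<Rightarrow> (nat \<times> nat) set \<Rightarrow> bool" where
  "is_chain N E \<longleftrightarrow> (\<exists>n l. path_from_root E n l \<and>
     N = {l k |k. enat k \<le> n} \<and> E = {(l k, l (Suc k)) |k. enat k < n})"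

text \<open>The root itself does not belong to the path \<open>P\<close>.\<close>

definition maximal_path :: "nat set \<Rightarrow> (nat \<times> nat) set \<Rightarrow> nat set \<Rightarrow> bool" where
  "maximal_path N E P \<longleftrightarrow> (\<exists>n l. 1 \<le> n \<and> path_from_root E n l \<and>
     P = {l k |k. 1 \<le> k \<and> enat k \<le> n} \<and>
     (\<forall>m. n = enat m \<longrightarrow> l m \<in> leaves N E))"

definition undirected_path :: "(nat \<times> nat) set \<Rightarrow> nat \<Rightarrow> nat \<Rightarrow> nat list \<Rightarrow> bool" where
  "undirected_path E a b p \<longleftrightarrow>
     p \<noteq> [] \<and> hd p = a \<and> last p = b \<and> distinct p \<and>
     successively (\<lambda>x y. (x, y) \<in> E \<or> (y, x) \<in> E) p"

definition path_between :: "(nat \<times> nat) set \<Rightarrow> nat \<Rightarrow> nat \<Rightarrow> nat set" where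
  "path_between E a b = {k. \<exists>p. undirected_path E a b p \<and> k \<in> set p - {a, b}}"

definition separates :: "(nat \<times> nat) set \<Rightarrow> nat \<Rightarrow> nat set \<Rightarrow> nat set \<Rightarrow> bool" where
  "separates E i A B \<longleftrightarrow> (\<forall>a\<in>A. \<forall>b\<in>B. i \<in> path_between E a b)"


section \<open>Conditioning and Markov tree dependence\<close>

definition cond_exp_given ::
  "'w measure \<Rightarrow> ('w \<Rightarrow> real) \<Rightarrow> ('w \<Rightarrow> real) \<Rightarrow> 'w \<Rightarrow> real" where
  "cond_exp_given M U Z = real_cond_exp M (vimage_algebra (space M) U borel) Z"

definition cond_indep_given ::
  "'w measure \<Rightarrow> 'a measure \<Rightarrow> ('w \<Rightarrow> 'a) \<Rightarrow> 'b measure \<Rightarrow> ('w \<Rightarrow> 'b) \<Rightarrow> ('w \<Rightarrow> real) \<Rightarrow> bool" where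
  "cond_indep_given M SA V SB W U \<longleftrightarrow> (\<forall>S\<in>sets SA. \<forall>T\<in>sets SB. AE \<omega> in M.
     cond_exp_given M U (indicator {\<omega> \<in> space M. V \<omega> \<in> S \<and> W \<omega> \<in> T}) \<omega> =
     cond_exp_given M U (indicator {\<omega> \<in> space M. V \<omega> \<in> S}) \<omega> *
     cond_exp_given M U (indicator {\<omega> \<in> space M. W \<omega> \<in> T}) \<omega>)"

definition subvec :: "(nat \<Rightarrow> 'w \<Rightarrow> real) \<Rightarrow> nat set \<Rightarrow> 'w \<Rightarrow> nat \<Rightarrow> real" where
  "subvec X J \<omega> = (\<lambda>j\<in>J. X j \<omega>)"

definition markov_tree_distributed ::
  "nat set \<Rightarrow> (nat \<times> nat) set \<Rightarrow> 'w measure \<Rightarrow> (nat \<Rightarrow> 'w \<Rightarrow> real) \<Rightarrow> bool" where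
  "markov_tree_distributed N E M X \<longleftrightarrow>
     (\<forall>n\<in>N. X n \<in> borel_measurable M) \<and>
     (\<forall>A B i. finite A \<longrightarrow> finite B \<longrightarrow> A \<subseteq> N \<longrightarrow> B \<subseteq> N \<longrightarrow> A \<inter> B = {} \<longrightarrow> i \<in> N \<longrightarrow>
        separates E i A B \<longrightarrow>
        cond_indep_given M (PiM A (\<lambda>_. borel)) (subvec X A) (PiM B (\<lambda>_. borel)) (subvec X B) (X i))"

text \<open>\<open>V \<up>\<^sub>s\<^sub>t U\<close>: the function \<open>g\<close> is a version of \<open>u \<mapsto> E[f(V) | U = u]\<close>. Any two versions agree
  outside a null set of the law of \<open>U\<close>, so the choice of version does not matter.\<close>

definition st_increasing :: "'w measure \<Rightarrow> ('w \<Rightarrow> real) \<Rightarrow> ('w \<Rightarrow> real) \<Rightarrow> bool" where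
  "st_increasing M V U \<longleftrightarrow>
     (\<forall>f :: real \<Rightarrow> real. mono f \<longrightarrow> integrable M (\<lambda>\<omega>. f (V \<omega>)) \<longrightarrow>
        (\<exists>g \<in> borel_measurable borel.
           (AE \<omega> in M. cond_exp_given M U (\<lambda>\<omega>. f (V \<omega>)) \<omega> = g (U \<omega>)) \<and>
           (\<exists>Z \<in> null_sets (distr M borel U). mono_on (- Z) g)))"


section \<open>Stochastic orders\<close>

text \<open>Vectors indexed by a finite set \<open>J\<close> are the extensional functions on \<open>J\<close>. The orders are
  relations between the laws of such vectors.\<close>

definition law :: "'w measure \<Rightarrow> (nat \<Rightarrow> 'w \<Rightarrow> real) \<Rightarrow> nat set \<Rightarrow> (nat \<Rightarrow> real) measure" where
  "law M X J = distr M (PiM J (\<lambda>_. borel)) (subvec X J)"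

text \<open>The law of the vector with independent components and the same marginals as \<open>(X\<^sub>j)\<^sub>j\<close>,
  \<open>j \<in> J\<close>.\<close>

definition indep_law :: "'w measure \<Rightarrow> (nat \<Rightarrow> 'w \<Rightarrow> real) \<Rightarrow> nat set \<Rightarrow> (nat \<Rightarrow> real) measure" where
  "indep_law M X J = PiM J (\<lambda>j. distr M borel (X j))"

definition lo_le :: "nat set \<Rightarrow> (nat \<Rightarrow> real) measure \<Rightarrow> (nat \<Rightarrow> real) measure \<Rightarrow> bool" where
  "lo_le J \<mu> \<nu> \<longleftrightarrow>
     (\<forall>t. measure \<mu> {x \<in> space \<mu>. \<forall>j\<in>J. x j \<le> t j} \<le> measure \<nu> {x \<in> space \<nu>. \<forall>j\<in>J. x j \<le> t j})"

definition supermodular :: "nat set \<Rightarrow> ((nat \<Rightarrow> real) \<Rightarrow> real) \<Rightarrow> bool" where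
  "supermodular J f \<longleftrightarrow>
     (\<forall>x \<in> J \<rightarrow>\<^sub>E UNIV. \<forall>y \<in> J \<rightarrow>\<^sub>E UNIV. f x + f y \<le> f (inf x y) + f (sup x y))"

definition weight :: "nat set \<Rightarrow> ((nat \<Rightarrow> real) \<Rightarrow> real) \<Rightarrow> bool" where
  "weight J b \<longleftrightarrow> b \<in> borel_measurable (PiM J (\<lambda>_. borel)) \<and> (\<forall>x \<in> J \<rightarrow>\<^sub>E UNIV. 1 \<le> b x)"

definition bounded_by_weight ::
  "nat set \<Rightarrow> ((nat \<Rightarrow> real) \<Rightarrow> real) \<Rightarrow> ((nat \<Rightarrow> real) \<Rightarrow> real) \<Rightarrow> bool" where
  "bounded_by_weight J b f \<longleftrightarrow> (\<exists>c. \<forall>x \<in> J \<rightarrow>\<^sub>E UNIV. \<bar>f x\<bar> / b x \<le> c)"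

text \<open>The supermodular order for the weight function \<open>b\<close> relates laws under which \<open>b\<close> is
  integrable, so that all expectations involved exist.\<close>

definition sm_le ::
  "((nat \<Rightarrow> real) \<Rightarrow> real) \<Rightarrow> nat set \<Rightarrow> (nat \<Rightarrow> real) measure \<Rightarrow> (nat \<Rightarrow> real) measure \<Rightarrow> bool" where
  "sm_le b J \<mu> \<nu> \<longleftrightarrow> integrable \<mu> b \<and> integrable \<nu> b \<and>
     (\<forall>f \<in> borel_measurable (PiM J (\<lambda>_. borel)).
        supermodular J f \<longrightarrow> bounded_by_weight J b f \<longrightarrow> integral\<^sup>L \<mu> f \<le> integral\<^sup>L \<nu> f)"

text \<open>A finite family is compared as one vector, an infinite one through all its
  finite-dimensional subvectors.\<close>

definition compared_sets :: "nat set \<Rightarrow> nat set set" where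
  "compared_sets N = (if finite N then {N} else {J. finite J \<and> J \<subseteq> N})"

definition seq_lo_le ::
  "nat set \<Rightarrow> 'w measure \<Rightarrow> (nat \<Rightarrow> 'w \<Rightarrow> real) \<Rightarrow> (nat \<Rightarrow> 'w \<Rightarrow> real) \<Rightarrow> bool" where
  "seq_lo_le N M X Y \<longleftrightarrow> (\<forall>J \<in> compared_sets N. lo_le J (law M X J) (law M Y J))"

text \<open>Here \<open>b J\<close> is the weight function used for vectors indexed by \<open>J\<close>.\<close>

definition seq_sm_le ::
  "(nat set \<Rightarrow> (nat \<Rightarrow> real) \<Rightarrow> real) \<Rightarrow> nat set \<Rightarrow> 'w measure \<Rightarrow>
   (nat \<Rightarrow> 'w \<Rightarrow> real) \<Rightarrow> (nat \<Rightarrow> 'w \<Rightarrow> real) \<Rightarrow> bool" where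
  "seq_sm_le b N M X Y \<longleftrightarrow> (\<forall>J \<in> compared_sets N. sm_le (b J) J (law M X J) (law M Y J))"

definition weight_integrable ::
  "(nat set \<Rightarrow> (nat \<Rightarrow> real) \<Rightarrow> real) \<Rightarrow> nat set \<Rightarrow> 'w measure \<Rightarrow> (nat \<Rightarrow> 'w \<Rightarrow> real) \<Rightarrow> bool" where
  "weight_integrable b N M X \<longleftrightarrow> (\<forall>J. finite J \<longrightarrow> J \<subseteq> N \<longrightarrow> integrable (law M X J) (b J))"


section \<open>Conditions on an edge\<close>

text \<open>The sets \<open>K\<close>, \<open>K'\<close> contain the end nodes exempted from a monotonicity requirement, so that
  the weakened conditions differ from the original ones by one more exempted node.\<close>

definition cond_i :: "'w measure \<Rightarrow> (nat \<Rightarrow> 'w \<Rightarrow> real) \<Rightarrow> nat set \<Rightarrow> nat \<times> nat \<Rightarrow> bool" where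
  "cond_i M X K = (\<lambda>(i, j). j \<notin> K \<longrightarrow> st_increasing M (X j) (X i))"

definition cond_ii ::
  "'w measure \<Rightarrow> (nat \<Rightarrow> 'w \<Rightarrow> real) \<Rightarrow> nat set \<Rightarrow> nat set \<Rightarrow> nat \<times> nat \<Rightarrow> bool" where
  "cond_ii M Y K K' = (\<lambda>(i, j). (j \<notin> K \<longrightarrow> st_increasing M (Y i) (Y j)) \<and>
     (j \<notin> K' \<longrightarrow> st_increasing M (Y j) (Y i)))"

definition cond_iii ::
  "(nat set \<Rightarrow> (nat \<Rightarrow> real) \<Rightarrow> real) \<Rightarrow> 'w measure \<Rightarrow> (nat \<Rightarrow> 'w \<Rightarrow> real) \<Rightarrow>
   (nat \<Rightarrow> 'w \<Rightarrow> real) \<Rightarrow> nat \<times> nat \<Rightarrow> bool" where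
  "cond_iii b M X Y = (\<lambda>(i, j). sm_le (b {i, j}) {i, j} (law M X {i, j}) (law M Y {i, j}))"

definition indep_sm_le ::
  "(nat set \<Rightarrow> (nat \<Rightarrow> real) \<Rightarrow> real) \<Rightarrow> 'w measure \<Rightarrow> (nat \<Rightarrow> 'w \<Rightarrow> real) \<Rightarrow> nat \<Rightarrow> nat \<Rightarrow> bool" where
  "indep_sm_le b M X i j = sm_le (b {i, j}) {i, j} (indep_law M X {i, j}) (law M X {i, j})"

end

theory Submission
  imports Defs
begin

text \<open>Let \<open>U\<close> be uniform on \<open>{0, 1, 2}\<close> and, given \<open>U\<close>, let \<open>A\<close> and \<open>B\<close> be independent coins whose
  conditional probabilities of showing \<open>0\<close> are \<open>q(U)/4\<close> and \<open>r(U)/4\<close>. Choose a path in the tree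
  with end nodes \<open>a\<close>, \<open>c\<close>, put \<open>A\<close> and \<open>B\<close> there, put \<open>U\<close> on a connected set \<open>C\<close> of nodes containing
  the interior of the path, and \<open>0\<close> everywhere else. Then \<open>P(A = 0, B = 0) = (\<Sum>u. q(u) r(u))/48\<close>,
  while the supermodular order of the pairs \<open>(U, A)\<close> only concerns the partial sums of \<open>q\<close>, and
  \<open>U \<up>\<^sub>s\<^sub>t A\<close> already holds as soon as these dominate the partial sums of a constant profile; only
  \<open>A \<up>\<^sub>s\<^sub>t U\<close> requires \<open>q\<close> to be decreasing. So, for a profile \<open>q\<close> that is not decreasing, enlarging
  partial sums can make \<open>\<Sum>u. q(u) r(u)\<close> smaller. The profiles \<open>(q, r)\<close> used for \<open>X\<close> and for \<open>Y\<close> are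
    \<^item> (a) \<open>(4,0,2), (4,0,2)\<close> and \<open>(4,1,1), (4,1,1)\<close>, with \<open>a = j\<^sup>*\<close>, \<open>C = {p}\<close> for the parent \<open>p\<close> of
      \<open>j\<^sup>*\<close>, and \<open>c\<close> the parent of \<open>p\<close>, or \<open>k\<^sup>*\<close> if \<open>p = 0\<close>;
    \<^item> (b) \<open>(4,0,2), (4,1,1)\<close> and \<open>(4,0,2), (4,2,0)\<close>, with \<open>C = {j\<^sup>*}\<close>, \<open>a\<close> the parent and \<open>c\<close> a child
      of \<open>j\<^sup>*\<close>;
    \<^item> (c) \<open>(2,2,2), (2,2,2)\<close> and \<open>(4,0,2), (2,4,0)\<close>, with \<open>a = j\<^sup>*\<close>, \<open>C\<close> the set of all proper
      ancestors of \<open>j\<^sup>*\<close>, and \<open>c\<close> the first node of \<open>P\<close> outside \<open>C\<close>.\<close>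

section \<open>Conditioning on finite uniform spaces\<close>

abbreviation uniform_on :: "'w set \<Rightarrow> 'w measure" where
  "uniform_on S \<equiv> measure_pmf (pmf_of_set S)"

text \<open>The elementary conditional expectation of \<open>Z\<close> given \<open>U = u\<close>
  under the uniform law on \<open>S\<close>. Over an empty fibre, division by zero yields
  \<open>0\<close>.\<close>

definition fibre_avg :: "'w set \<Rightarrow> ('w \<Rightarrow> 'u) \<Rightarrow> ('w \<Rightarrow> real) \<Rightarrow> 'u \<Rightarrow> real" where
  "fibre_avg S U Z u = (\<Sum>x | x \<in> S \<and> U x = u. Z x) / real (card {x \<in> S. U x = u})"

lemma borel_measurable_finite_support:
  fixes g :: "real \<Rightarrow> real"
  assumes "finite F" "\<And>u. u \<notin> F \<Longrightarrow> g u = 0"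
  shows "g \<in> borel_measurable borel"
proof -
  have "g = (\<lambda>u. \<Sum>v\<in>F. g v * indicator {v} u)"
  proof
    fix u
    have "(\<Sum>v\<in>F. g v * indicator {v} u) = (\<Sum>v\<in>F. if u = v then g v else 0)"
      by (intro sum.cong) (auto simp: indicator_def)
    also have "\<dots> = g u" using assms by simp
    finally show "g u = (\<Sum>v\<in>F. g v * indicator {v} u)" ..
  qed
  also have "\<dots> \<in> borel_measurable borel" by measurable
  finally show ?thesis .
qed

lemma fibre_avg_measurable:
  fixes U :: "'w \<Rightarrow> real"
  assumes "finite S"
  shows "fibre_avg S U Z \<in> borel_measurable borel"
proof (rule borel_measurable_finite_support)
  show "finite (U ` S)" using assms by simp
  fix u assume "u \<notin> U ` S"
  then have e: "{x. x \<in> S \<and> U x = u} = {}" by auto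
  show "fibre_avg S U Z u = 0" unfolding fibre_avg_def e by simp
qed

text \<open>Events generated by \<open>U\<close> are preimages under \<open>U\<close>, hence unions
  of fibres, and replacing \<open>Z\<close> by its average over a fibre keeps the sum over that
  fibre.\<close>

lemma cond_exp_given_uniform:
  assumes S: "finite S" "S \<noteq> {}"
  shows "AE \<omega> in uniform_on S. cond_exp_given (uniform_on S) U Z \<omega> = fibre_avg S U Z (U \<omega>)"
proof -
  let ?M = "uniform_on S"
  let ?F = "vimage_algebra (space ?M) U borel"
  have sub: "subalgebra ?M ?F" by (simp add: subalgebra_def)
  interpret finite_measure_subalgebra ?M ?F
    by (standard) (use sub in auto)
  have int: "integrable ?M h" for h :: "'a \<Rightarrow> real"
    by (rule integrable_measure_pmf_finite) (use S in simp)
  have meas: "(\<lambda>\<omega>. fibre_avg S U Z (U \<omega>)) \<in> borel_measurable ?F"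
    by (rule measurable_compose[OF measurable_vimage_algebra1 fibre_avg_measurable[OF S(1)]]) auto
  have eq: "set_lebesgue_integral ?M A Z =
      set_lebesgue_integral ?M A (\<lambda>\<omega>. fibre_avg S U Z (U \<omega>))" if "A \<in> sets ?F" for A
  proof -
    from that obtain B where A: "A = U -` B" by (auto simp: sets_vimage_algebra2)
    have "(\<Sum>\<omega>\<in>S. indicator A \<omega> * Z \<omega>) =
        (\<Sum>u\<in>U ` S. \<Sum>\<omega>\<in>{x\<in>S. U x = u}. indicator A \<omega> * Z \<omega>)"
      by (rule sum.image_gen[OF S(1)])
    also have "\<dots> = (\<Sum>u\<in>U ` S. \<Sum>\<omega>\<in>{x\<in>S. U x = u}. indicator A \<omega> * fibre_avg S U Z (U \<omega>))"
    proof (rule sum.cong[OF refl])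
      fix u assume "u \<in> U ` S"
      then have c: "card {x\<in>S. U x = u} \<noteq> 0" using S by auto
      have "(\<Sum>\<omega>\<in>{x\<in>S. U x = u}. indicator A \<omega> * Z \<omega>)
          = (\<Sum>\<omega>\<in>{x\<in>S. U x = u}. indicator B u * Z \<omega>)"
        by (intro sum.cong) (auto simp: A indicator_def)
      also have "\<dots> = (\<Sum>\<omega>\<in>{x\<in>S. U x = u}. indicator B u * fibre_avg S U Z u)"
        using c by (simp add: fibre_avg_def sum_distrib_left[symmetric])
      also have "\<dots> = (\<Sum>\<omega>\<in>{x\<in>S. U x = u}. indicator A \<omega> * fibre_avg S U Z (U \<omega>))"
        by (intro sum.cong) (auto simp: A indicator_def)
      finally show "(\<Sum>\<omega>\<in>{x\<in>S. U x = u}. indicator A \<omega> * Z \<omega>) =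
        (\<Sum>\<omega>\<in>{x\<in>S. U x = u}. indicator A \<omega> * fibre_avg S U Z (U \<omega>))" .
    qed
    also have "\<dots> = (\<Sum>\<omega>\<in>S. indicator A \<omega> * fibre_avg S U Z (U \<omega>))"
      by (rule sum.image_gen[OF S(1), symmetric])
    finally show ?thesis
      unfolding set_lebesgue_integral_def by (simp add: integral_pmf_of_set S)
  qed
  show ?thesis unfolding cond_exp_given_def
    by (rule real_cond_exp_charact[OF eq int int meas])
qed

lemma cond_indep_given_uniformI:
  assumes S: "finite S" "S \<noteq> {}"
    and "\<And>A B \<omega>. \<omega> \<in> S \<Longrightarrow>
      fibre_avg S U (indicator {\<omega>. V \<omega> \<in> A \<and> W \<omega> \<in> B}) (U \<omega>) =
      fibre_avg S U (indicator {\<omega>. V \<omega> \<in> A}) (U \<omega>) *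
      fibre_avg S U (indicator {\<omega>. W \<omega> \<in> B}) (U \<omega>)"
  shows "cond_indep_given (uniform_on S) SA V SB W U"
  unfolding cond_indep_given_def
proof (intro ballI)
  fix A B
  have *: "AE \<omega> in uniform_on S. \<omega> \<in> S"
    using S by (simp add: AE_measure_pmf_iff)
  show "AE \<omega> in uniform_on S.
       cond_exp_given (uniform_on S) U
        (indicator {\<omega> \<in> space (uniform_on S). V \<omega> \<in> A \<and> W \<omega> \<in> B}) \<omega> =
       cond_exp_given (uniform_on S) U
        (indicator {\<omega> \<in> space (uniform_on S). V \<omega> \<in> A}) \<omega> *
       cond_exp_given (uniform_on S) U
        (indicator {\<omega> \<in> space (uniform_on S). W \<omega> \<in> B}) \<omega>"
    using *
      cond_exp_given_uniform[OF S, of U "indicator {\<omega>. V \<omega> \<in> A \<and> W \<omega> \<in> B}"]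
      cond_exp_given_uniform[OF S, of U "indicator {\<omega>. V \<omega> \<in> A}"]
      cond_exp_given_uniform[OF S, of U "indicator {\<omega>. W \<omega> \<in> B}"]
    by eventually_elim (simp add: assms(3))
qed

lemma fibre_avg_indicator_determined:
  assumes S: "finite S" "\<omega> \<in> S"
    and det: "\<And>\<omega>'. \<omega>' \<in> S \<Longrightarrow> U \<omega>' = U \<omega> \<Longrightarrow> \<omega>' \<in> D \<longleftrightarrow> \<omega> \<in> D"
  shows "fibre_avg S U (indicator (D \<inter> Z)) (U \<omega>) =
    indicator D \<omega> * fibre_avg S U (indicator Z) (U \<omega>)"
proof -
  have "(\<Sum>x | x \<in> S \<and> U x = U \<omega>. indicator (D \<inter> Z) x) =
    (\<Sum>x | x \<in> S \<and> U x = U \<omega>. indicator D \<omega> * indicator Z x :: real)"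
    by (intro sum.cong) (auto simp: indicator_def det)
  then show ?thesis by (simp add: fibre_avg_def sum_distrib_left[symmetric])
qed

lemma fibre_avg_const:
  assumes "finite S" "\<omega> \<in> S" "\<And>\<omega>'. \<omega>' \<in> S \<Longrightarrow> U \<omega>' = U \<omega> \<Longrightarrow> Z \<omega>' = c"
  shows "fibre_avg S U Z (U \<omega>) = c"
proof -
  have "card {x\<in>S. U x = U \<omega>} \<noteq> 0" using assms by auto
  then show ?thesis using assms(3) by (simp add: fibre_avg_def)
qed

text \<open>Given \<open>U\<close>, the vector \<open>V\<close> is constant and therefore
  independent of anything. Both orders are recorded because either side of a separation may be the
  determined one.\<close>

lemma cond_indep_given_determined:
  assumes S: "finite S" "S \<noteq> {}"
    and det: "\<And>\<omega> \<omega>'. \<omega> \<in> S \<Longrightarrow> \<omega>' \<in> S \<Longrightarrow> U \<omega>' = U \<omega> \<Longrightarrow> V \<omega>' = V \<omega>"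
  shows "cond_indep_given (uniform_on S) SA V SB W U"
    and "cond_indep_given (uniform_on S) SB W SA V U"
proof -
  have "fibre_avg S U (indicator {\<omega>. V \<omega> \<in> A \<and> W \<omega> \<in> B}) (U \<omega>) =
      fibre_avg S U (indicator {\<omega>. V \<omega> \<in> A}) (U \<omega>) *
      fibre_avg S U (indicator {\<omega>. W \<omega> \<in> B}) (U \<omega>)" if "\<omega> \<in> S" for A B \<omega>
  proof -
    have "fibre_avg S U (indicator ({\<omega>. V \<omega> \<in> A} \<inter> {\<omega>. W \<omega> \<in> B})) (U \<omega>) =
      indicator {\<omega>. V \<omega> \<in> A} \<omega> * fibre_avg S U (indicator {\<omega>. W \<omega> \<in> B}) (U \<omega>)"
      by (rule fibre_avg_indicator_determined[OF S(1) that]) (metis det that mem_Collect_eq)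
    moreover have "fibre_avg S U (indicator {\<omega>. V \<omega> \<in> A}) (U \<omega>) = indicator {\<omega>. V \<omega> \<in> A} \<omega>"
      by (rule fibre_avg_const[OF S(1) that]) (simp add: indicator_def det[OF that])
    ultimately show ?thesis by (simp add: Int_def)
  qed
  then show "cond_indep_given (uniform_on S) SA V SB W U"
    and "cond_indep_given (uniform_on S) SB W SA V U"
    by (auto intro!: cond_indep_given_uniformI[OF S] simp: conj_commute mult.commute)
qed

lemma st_increasing_uniformI:
  assumes S: "finite S" "S \<noteq> {}"
    and inc: "\<And>f x y. mono f \<Longrightarrow> x \<in> S \<Longrightarrow> y \<in> S \<Longrightarrow> U x \<le> U y \<Longrightarrow>
      fibre_avg S U (\<lambda>\<omega>. f (V \<omega>)) (U x) \<le> fibre_avg S U (\<lambda>\<omega>. f (V \<omega>)) (U y)"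
  shows "st_increasing (uniform_on S) V U"
  unfolding st_increasing_def
proof (intro allI impI)
  fix f :: "real \<Rightarrow> real" assume f: "mono f"
  let ?g = "fibre_avg S U (\<lambda>\<omega>. f (V \<omega>))"
  have "finite (U ` S)" using S by simp
  \<comment> \<open>The values not attained by \<open>U\<close> on \<open>S\<close> form a null set,
    so monotonicity only has to be checked between points of \<open>S\<close>.\<close>
  then have "- (U ` S) \<in> null_sets (distr (uniform_on S) borel U)"
    using S by (subst null_sets_distr_iff)
      (auto simp: null_sets_def emeasure_pmf_of_set vimage_def intro!: measure_pmf_zero_iff[THEN iffD2]
        borel_open open_Compl finite_imp_closed)
  moreover have "mono_on (- (- (U ` S))) ?g"
    by (rule mono_onI) (use inc[OF f] in auto)
  ultimately show "\<exists>g\<in>borel_measurable borel.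
       (AE \<omega> in uniform_on S. cond_exp_given (uniform_on S) U (\<lambda>\<omega>. f (V \<omega>)) \<omega> = g (U \<omega>)) \<and>
       (\<exists>Z\<in>null_sets (distr (uniform_on S) borel U). mono_on (- Z) g)"
    using cond_exp_given_uniform[OF S, of U "\<lambda>\<omega>. f (V \<omega>)"]
      fibre_avg_measurable[OF S(1), of U] by blast
qed

text \<open>By antisymmetry \<open>det\<close> also makes \<open>V\<close> a function of
  \<open>U\<close>, so each fibre average of \<open>f (V \<omega>)\<close> is a single value of
  \<open>f\<close>.\<close>

lemma st_increasing_determined:
  assumes S: "finite S" "S \<noteq> {}"
    and det: "\<And>x y. x \<in> S \<Longrightarrow> y \<in> S \<Longrightarrow> U x \<le> U y \<Longrightarrow> V x \<le> V y"
  shows "st_increasing (uniform_on S) V U"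
proof (rule st_increasing_uniformI[OF S])
  fix f :: "real \<Rightarrow> real" and x y
  assume f: "mono f" and xy: "x \<in> S" "y \<in> S" "U x \<le> U y"
  have "fibre_avg S U (\<lambda>\<omega>. f (V \<omega>)) (U z) = f (V z)" if "z \<in> S" for z
    by (rule fibre_avg_const) (use S that det in \<open>auto intro!: arg_cong[of _ _ f] antisym\<close>)
  then show "fibre_avg S U (\<lambda>\<omega>. f (V \<omega>)) (U x) \<le> fibre_avg S U (\<lambda>\<omega>. f (V \<omega>)) (U y)"
    using xy f det by (simp add: monoD)
qed

lemma st_increasing_const:
  assumes S: "finite S" "S \<noteq> {}"
    and const: "\<And>x y. x \<in> S \<Longrightarrow> y \<in> S \<Longrightarrow> U x = U y"
  shows "st_increasing (uniform_on S) V U"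
  by (rule st_increasing_uniformI[OF S]) (metis const order_refl)

section \<open>Paths in directed trees\<close>

lemma walk_imp_rtrancl:
  assumes "directed_walk E x y p" shows "(x, y) \<in> E\<^sup>*"
proof -
  have "successively (\<lambda>x y. (x, y) \<in> E) p \<Longrightarrow> p \<noteq> [] \<Longrightarrow> (hd p, last p) \<in> E\<^sup>*"
    by (induction p rule: induct_list012) (auto intro: converse_rtrancl_into_rtrancl)
  then show ?thesis using assms by (auto simp: directed_walk_def)
qed

lemma walk_snoc:
  assumes "directed_walk E x y p" "(y, z) \<in> E"
  shows "directed_walk E x z (p @ [z])"
  using assms by (auto simp: directed_walk_def successively_append_iff)

text \<open>Keeping \<open>p\<close> as a prefix allows uniqueness of walks to be contradicted by
  comparing lengths.\<close>

lemma walk_extend: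
  assumes "directed_walk E x y p" "(y, z) \<in> E\<^sup>*"
  shows "\<exists>q. directed_walk E x z (p @ q)"
  using assms(2)
proof (induction rule: rtrancl_induct)
  case base
  then show ?case using assms(1) by (intro exI[of _ "[]"]) simp
next
  case (step y z)
  then show ?case using walk_snoc by (metis append.assoc)
qed

context
  fixes N :: "nat set" and E :: "(nat \<times> nat) set"
  assumes tree: "directed_tree N E"
begin

lemma edge_nodes: "(i, j) \<in> E \<Longrightarrow> i \<in> N \<and> j \<in> N"
proof -
  have "E \<subseteq> N \<times> N" using tree by (simp add: directed_tree_def)
  then show "(i, j) \<in> E \<Longrightarrow> i \<in> N \<and> j \<in> N" by blast
qed

lemma node_set: "is_node_set N"
  using tree by (simp add: directed_tree_def)

lemma walk_from_root: "i \<in> N \<Longrightarrow> \<exists>p. directed_walk E 0 i p"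
proof (cases "i = 0")
  case True
  have "directed_walk E 0 0 [0]" by (simp add: directed_walk_def)
  then show ?thesis using True by blast
next
  case False
  then show "i \<in> N \<Longrightarrow> ?thesis" using tree unfolding directed_tree_def by blast
qed

lemma walk_unique:
  assumes "i \<in> N" "i \<noteq> 0" "directed_walk E 0 i p" "directed_walk E 0 i q"
  shows "p = q"
proof -
  have "\<exists>!p. directed_walk E 0 i p" using tree assms(1,2) by (simp add: directed_tree_def)
  then show ?thesis using assms(3,4) by metis
qed

lemma root_reaches: "i \<in> N \<Longrightarrow> (0, i) \<in> E\<^sup>*"
  using walk_from_root walk_imp_rtrancl by blast

text \<open>Uniqueness of walks is only assumed for targets other than the root. A non-root node
  \<open>m\<close> therefore serves as target: going round the closed walk through the root first
  would give a second walk to \<open>m\<close>.\<close>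

lemma no_edge_to_root: "(i, 0) \<notin> E"
proof
  assume e: "(i, 0) \<in> E"
  obtain m where m: "m \<in> N" "m \<noteq> 0"
    using node_set that[of 1] by (auto simp: is_node_set_def)
  obtain p where p: "directed_walk E 0 i p" using walk_from_root edge_nodes[OF e] by blast
  obtain q where q: "directed_walk E 0 m ((p @ [0]) @ q)"
    using walk_extend[OF walk_snoc[OF p e] root_reaches[OF m(1)]] by blast
  have "directed_walk E 0 0 [0]" by (simp add: directed_walk_def)
  then obtain q' where q': "directed_walk E 0 m ([0] @ q')"
    using walk_extend root_reaches[OF m(1)] by blast
  have "directed_walk E 0 m ((p @ [0]) @ q')"
  proof (cases q')
    case Nil
    then show ?thesis using q' m(2) by (simp add: directed_walk_def)
  next
    case (Cons y ys)
    moreover have "hd (p @ r) = hd p" for r using p by (simp add: directed_walk_def)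
    ultimately show ?thesis using q' walk_snoc[OF p e]
      by (auto simp: directed_walk_def successively_append_iff)
  qed
  then have "(p @ [0]) @ q' = [0] @ q'"
    using walk_unique[OF m _ q'] by blast
  then show False using p by (auto simp: directed_walk_def)
qed

lemma edge_target_not_root: "(i, j) \<in> E \<Longrightarrow> j \<noteq> 0"
  using no_edge_to_root[of i] by (cases j) simp_all

text \<open>Walks to both parents, prolonged by \<open>j\<close>, are the same walk, so their last
  nodes but one agree.\<close>

lemma parent_unique: "(i, j) \<in> E \<Longrightarrow> (i', j) \<in> E \<Longrightarrow> i = i'"
proof -
  assume e: "(i, j) \<in> E" "(i', j) \<in> E"
  have j: "j \<in> N" "j \<noteq> 0" using edge_nodes[OF e(1)] edge_target_not_root[OF e(1)] by auto
  have "i \<in> N" "i' \<in> N" using e edge_nodes by simp_all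
  then obtain p p' where p: "directed_walk E 0 i p" "directed_walk E 0 i' p'"
    using walk_from_root by meson
  have "p @ [j] = p' @ [j]"
    using walk_unique[OF j walk_snoc[OF p(1) e(1)] walk_snoc[OF p(2) e(2)]] .
  then show "i = i'" using p by (auto simp: directed_walk_def)
qed

lemma parent_eq: "(i, j) \<in> E \<Longrightarrow> parent E j = i"
  unfolding parent_def by (blast intro: the_equality parent_unique)

text \<open>A walk to \<open>i\<close> followed by one round of the cycle would be a longer walk to
  \<open>i\<close>.\<close>

lemma tree_acyclic: "(i, i) \<notin> E\<^sup>+"
proof
  assume "(i, i) \<in> E\<^sup>+"
  then obtain j where j: "(i, j) \<in> E\<^sup>*" "(j, i) \<in> E" using tranclD2[of i i E] by blast
  have i: "i \<in> N" "i \<noteq> 0" using edge_nodes[OF j(2)] edge_target_not_root[OF j(2)] by auto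
  obtain p where p: "directed_walk E 0 i p" using walk_from_root i by blast
  obtain q where q: "directed_walk E 0 j (p @ q)" using walk_extend[OF p j(1)] by blast
  have "(p @ q) @ [i] = p" using walk_unique[OF i walk_snoc[OF q j(2)] p] .
  then show False by simp
qed

text \<open>The last step of a walk from \<open>x\<close> to \<open>v\<close> comes from the only
  parent of \<open>v\<close>. Thus the subtree below \<open>x\<close> can only be entered from above
  through \<open>x\<close>.\<close>

lemma parent_reached:
  assumes "(x, v) \<in> E\<^sup>*" "v \<noteq> x" "(u, v) \<in> E"
  shows "(x, u) \<in> E\<^sup>*"
  using assms(1)
proof (cases rule: rtranclE)
  case base
  then show ?thesis using assms(2) by simp
next
  case (step w)
  then show ?thesis using parent_unique[OF step(2) assms(3)] by simp
qed

text \<open>The assumption \<open>v \<in> set p\<close> in \<open>step\<close> is what later brings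
  in distinctness: a step to a node already visited is excluded.\<close>

lemma successively_invariant:
  assumes "successively R p" "p \<noteq> []" "hd p \<in> D"
    and step: "\<And>u v. u \<in> D \<Longrightarrow> R u v \<Longrightarrow> v \<in> set p \<Longrightarrow> v \<in> D"
  shows "set p \<subseteq> D"
proof -
  have "set q \<subseteq> set p \<Longrightarrow> successively R q \<Longrightarrow> q \<noteq> [] \<Longrightarrow> hd q \<in> D \<Longrightarrow> set q \<subseteq> D" for q
  proof (induction q)
    case (Cons x q)
    show ?case
    proof (cases "q = []")
      case True
      then show ?thesis using Cons.prems by simp
    next
      case False
      then have "R x (hd q)" "successively R q" "hd q \<in> set p"
        using Cons.prems by (auto simp: successively_Cons)
      then show ?thesis using Cons False step[of x "hd q"] by simp
    qed
  qed simp
  then show ?thesis using assms(1-3) by blast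
qed

text \<open>A path that leaves \<open>S\<close> moves either into the subtree below a child outside \<open>S\<close> or from
  the top node \<open>r\<close> to its parent; in both cases it would have to revisit a node to return.\<close>

lemma undirected_path_stays:
  assumes S: "S \<subseteq> E\<^sup>* `` {r}" "\<And>s u. s \<in> S \<Longrightarrow> s \<noteq> r \<Longrightarrow> (u, s) \<in> E \<Longrightarrow> u \<in> S"
    and "undirected_path E x y p" "x \<in> S" "y \<in> S"
  shows "set p \<subseteq> S"
  using assms(3,4)
proof (induction p arbitrary: x)
  case Nil
  then show ?case by simp
next
  case (Cons z p)
  let ?R = "\<lambda>x y. (x, y) \<in> E \<or> (y, x) \<in> E"
  from Cons.prems have z: "z = x" "x \<notin> set p" by (auto simp: undirected_path_def)
  show ?case
  proof (cases p)
    case Nil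
    then show ?thesis using Cons.prems z by simp
  next
    case (Cons x' q)
    then have p: "p \<noteq> []" "hd p = x'" by auto
    have path: "successively ?R p" "distinct p" "last p = y" "?R x x'"
      using Cons.prems Cons z by (auto simp: undirected_path_def)
    have last: "y \<in> set p" using path p by auto
    have "x' \<in> S"
    proof (rule ccontr)
      assume x': "x' \<notin> S"
      from path(4) show False
      proof
        assume e: "(x, x') \<in> E"
        \<comment> \<open>The only way out of the subtree below \<open>x'\<close> leads through its
          parent \<open>x\<close>, which is not visited again.\<close>
        have "set p \<subseteq> E\<^sup>* `` {x'}"
        proof (rule successively_invariant[OF path(1) p(1)])
          fix u v assume u: "u \<in> E\<^sup>* `` {x'}" "?R u v" "v \<in> set p"
          then have "(u, v) \<in> E \<or> u \<noteq> x'" using z(2) parent_unique[OF e] by blast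
          then show "v \<in> E\<^sup>* `` {x'}"
            using u parent_reached[of x' u v] by (auto intro: rtrancl_into_rtrancl)
        qed (use p in auto)
        then have "(x', y) \<in> E\<^sup>*" using last by auto
        \<comment> \<open>Climbing from \<open>y\<close> towards \<open>x'\<close> stays in
          \<open>S\<close> until the top \<open>r\<close> is met, by closure under parents. Since
          \<open>x' \<notin> S\<close>, it lies above \<open>r\<close> and hence above
          \<open>x\<close>, a cycle.\<close>
        then have "x' \<in> S \<or> (x', r) \<in> E\<^sup>*"
        proof (induction rule: converse_rtrancl_induct)
          case base
          then show ?case using \<open>y \<in> S\<close> by simp
        next
          case (step u v)
          then show ?case using S(2) by (metis r_into_rtrancl rtrancl_trans)
        qed
        then have "(x', x) \<in> E\<^sup>*" using x' S(1) \<open>x \<in> S\<close> by (auto intro: rtrancl_trans)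
        then show False using e tree_acyclic by (meson rtrancl_into_trancl2)
      next
        assume e: "(x', x) \<in> E"
        then have x: "x = r" using S(2) x' \<open>x \<in> S\<close> by blast
        \<comment> \<open>Outside the subtree below \<open>r\<close>, the path could come back only
          through \<open>r\<close>, which is \<open>x\<close> and already used.\<close>
        have "set p \<subseteq> - E\<^sup>* `` {r}"
        proof (rule successively_invariant[OF path(1) p(1)])
          show "hd p \<in> - E\<^sup>* `` {r}"
            using rtrancl_into_trancl1[OF _ e] tree_acyclic p(2) x by blast
          fix u v assume "u \<in> - E\<^sup>* `` {r}" "?R u v" "v \<in> set p"
          then show "v \<in> - E\<^sup>* `` {r}"
            using z(2) x parent_reached[of r v u] by (auto intro: rtrancl_into_rtrancl)
        qed
        then show False using last S(1) \<open>y \<in> S\<close> by auto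
      qed
    qed
    moreover have "undirected_path E x' y p"
      using path p by (simp add: undirected_path_def)
    ultimately show ?thesis using Cons.IH[of x'] \<open>x \<in> S\<close> z(1) by simp
  qed
qed

text \<open>The path stays in \<open>S\<close>, so an interior node has two different neighbours in
  \<open>S\<close>, one on either side. By \<open>one\<close>, neither \<open>a\<close> nor
  \<open>c\<close> has that many.\<close>

lemma path_between_core:
  assumes S: "S = insert a (insert c C)" "S \<subseteq> E\<^sup>* `` {r}"
    "\<And>s u. s \<in> S \<Longrightarrow> s \<noteq> r \<Longrightarrow> (u, s) \<in> E \<Longrightarrow> u \<in> S"
    and one: "\<And>s u v. s \<in> {a, c} \<Longrightarrow> u \<in> S \<Longrightarrow> v \<in> S \<Longrightarrow> (u, s) \<in> E \<or> (s, u) \<in> E \<Longrightarrow>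
      (v, s) \<in> E \<or> (s, v) \<in> E \<Longrightarrow> u = v"
    and xy: "x \<in> S" "y \<in> S"
  shows "path_between E x y \<subseteq> C"
proof
  fix k assume "k \<in> path_between E x y"
  then obtain p where p: "undirected_path E x y p" "k \<in> set p" "k \<noteq> x" "k \<noteq> y"
    by (auto simp: path_between_def)
  have sub: "set p \<subseteq> S" by (rule undirected_path_stays[OF S(2) _ p(1) xy]) (use S(3) in blast)
  from p(2) obtain xs ys where ys: "p = xs @ k # ys" by (meson split_list)
  have ne: "xs \<noteq> []" "ys \<noteq> []" using p ys by (auto simp: undirected_path_def)
  then have mem: "last xs \<in> set xs" "hd ys \<in> set ys" by simp_all
  have "set xs \<inter> set ys = {}" using p(1) ys by (simp add: undirected_path_def)
  then have "last xs \<in> S" "hd ys \<in> S" "last xs \<noteq> hd ys" using mem sub ys by auto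
  moreover have "(last xs, k) \<in> E \<or> (k, last xs) \<in> E" "(hd ys, k) \<in> E \<or> (k, hd ys) \<in> E"
    using p(1) ne ys by (auto simp: undirected_path_def successively_append_iff successively_Cons)
  ultimately have "k \<notin> {a, c}" using one by blast
  moreover have "k \<in> S" using sub p(2) by blast
  ultimately show "k \<in> C" using S(1) by blast
qed

end

section \<open>Two coins with a common centre\<close>

text \<open>A sample point is given by its first three coordinates: the value of the centre and
  the two dice that decide the coins.\<close>

definition point :: "nat \<Rightarrow> nat \<Rightarrow> nat \<Rightarrow> nat \<Rightarrow> real" where
  "point u v w = (\<lambda>n. if n = 0 then real u else if n = 1 then real v else if n = 2 then real w else 0)"

definition cube :: "(nat \<Rightarrow> real) set" where
  "cube = (\<lambda>(u, v, w). point u v w) ` ({..<3} \<times> {..<4} \<times> {..<4})"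

text \<open>Die \<open>k\<close> is uniform on \<open>0, ..., 3\<close>, so for
  \<open>q \<le> 4\<close> exactly \<open>q\<close> of its four outcomes give the value
  \<open>0\<close>.\<close>

definition coin :: "nat \<Rightarrow> (real \<Rightarrow> nat) \<Rightarrow> (nat \<Rightarrow> real) \<Rightarrow> real" where
  "coin k q \<omega> = (if \<omega> k < real (q (\<omega> 0)) then 0 else 1)"

text \<open>The last value is taken at all remaining reals, so that bounds over all arguments reduce
  to the three entries.\<close>

definition triple :: "nat \<Rightarrow> nat \<Rightarrow> nat \<Rightarrow> real \<Rightarrow> nat" where
  "triple x y z u = (if u = 0 then x else if u = 1 then y else z)"

section \<open>Counting points of the cube\<close>

lemma point_simps [simp]:
  "point u v w 0 = real u" "point u v w (Suc 0) = real v" "point u v w 2 = real w"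
  by (auto simp: point_def)

lemma point_eq_iff: "point u v w = point u' v' w' \<longleftrightarrow> u = u' \<and> v = v' \<and> w = w'"
  by (metis of_nat_eq_iff point_simps)

lemma inj_point: "inj (\<lambda>(u, v, w). point u v w)"
  by (auto simp: inj_def point_eq_iff)

lemma finite_cube [simp]: "finite cube"
  by (simp add: cube_def)

lemma card_cube: "card cube = 48"
  unfolding cube_def by (subst card_image) (auto intro: inj_on_subset[OF inj_point])

lemma point_in_cube [simp]: "point u v w \<in> cube \<longleftrightarrow> u < 3 \<and> v < 4 \<and> w < 4"
  by (auto simp: cube_def image_iff point_eq_iff)

lemma cube_nonempty [simp]: "cube \<noteq> {}"
  using point_in_cube[of 0 0 0] by (metis empty_iff zero_less_numeral)

lemma sum_cube: "(\<Sum>\<omega>\<in>cube. f \<omega>) = (\<Sum>u<3. \<Sum>v<4. \<Sum>w<4. f (point u v w))"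
proof -
  have "(\<Sum>\<omega>\<in>cube. f \<omega>) =
      (\<Sum>t\<in>{..<3} \<times> {..<4} \<times> {..<4}. f (case t of (u, v, w) \<Rightarrow> point u v w))"
    unfolding cube_def
    by (subst sum.reindex) (rule inj_on_subset[OF inj_point], simp_all)
  then show ?thesis by (simp add: sum.cartesian_product case_prod_unfold)
qed

lemma sum_lessThan_3: "(\<Sum>u<3. f u) = f 0 + f 1 + (f (2 :: nat) :: 'a :: comm_monoid_add)"
  by (simp add: numeral_3_eq_3 numeral_2_eq_2)

lemma sum_lessThan_4: "(\<Sum>u<4. f u) = f 0 + f 1 + f 2 + (f (3 :: nat) :: 'a :: comm_monoid_add)"
  by (simp add: numeral_eq_Suc)

lemma nat_le_4: "(n :: nat) \<le> 4 \<Longrightarrow> n = 0 \<or> n = 1 \<or> n = 2 \<or> n = 3 \<or> n = 4"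
  by auto

lemma sum_die:
  assumes "n \<le> 4"
  shows "(\<Sum>v<4. f (if real v < real n then 0 else 1 :: real)) =
    real n * f 0 + (4 - real n) * (f 1 :: real)"
  using nat_le_4[OF assms] by (auto simp: sum_lessThan_4)

text \<open>The outer factor \<open>4\<close> counts the outcomes of the die at which the coin does
  not look.\<close>

lemma sum_cube_coin:
  assumes k: "k \<in> {1, 2}" and q: "\<And>u. q u \<le> 4"
  shows "(\<Sum>\<omega>\<in>cube. f (\<omega> 0) (coin k q \<omega>)) =
    4 * (\<Sum>u<3. real (q (real u)) * f (real u) 0 + (4 - real (q (real u))) * (f (real u) 1 :: real))"
proof -
  have "(\<Sum>v<4. \<Sum>w<4. f (real u) (coin k q (point u v w))) =
    4 * (real (q (real u)) * f (real u) 0 + (4 - real (q (real u))) * f (real u) 1)" for u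
  proof -
    have "(\<Sum>v<4. f (real u) (if real v < real (q (real u)) then 0 else 1)) =
      real (q (real u)) * f (real u) 0 + (4 - real (q (real u))) * f (real u) 1"
      by (rule sum_die) (rule q)
    then show ?thesis using k by (auto simp: coin_def simp flip: sum_distrib_left)
  qed
  then show ?thesis by (simp add: sum_cube sum_distrib_left)
qed

text \<open>Numerator and denominator become sums over the whole cube, the form to which
  \<open>sum_cube_coin\<close> applies.\<close>

lemma fibre_avg_eq: "fibre_avg cube U Z u =
    (\<Sum>\<omega>\<in>cube. if U \<omega> = u then Z \<omega> else 0) / (\<Sum>\<omega>\<in>cube. if U \<omega> = u then 1 else 0)"
  unfolding fibre_avg_def by (simp add: sum.If_cases Int_def)

section \<open>Monotonicity and conditional independence of coins and centre\<close>

lemma cube_0: "\<omega> \<in> cube \<Longrightarrow> \<omega> 0 = 0 \<or> \<omega> 0 = 1 \<or> \<omega> 0 = 2"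
  unfolding cube_def by (auto simp: lessThan_def less_Suc_eq numeral_3_eq_3)

lemma coin_cases: "coin k q \<omega> = 0 \<or> coin k q \<omega> = 1"
  by (simp add: coin_def)

text \<open>The partial sums of \<open>q\<close> dominate those of the constant profile \<open>2\<close>: the coin is fair and
  positively (not necessarily monotonically) dependent on the centre.\<close>

definition profile :: "(real \<Rightarrow> nat) \<Rightarrow> bool" where
  "profile q \<longleftrightarrow> (\<forall>u. q u \<le> 4) \<and> 2 \<le> q 0 \<and> 4 \<le> q 0 + q 1 \<and> q 0 + q 1 + q 2 = 6"

definition dominated :: "(real \<Rightarrow> nat) \<Rightarrow> (real \<Rightarrow> nat) \<Rightarrow> bool" where
  "dominated q q' \<longleftrightarrow> q 0 \<le> q' 0 \<and> q 0 + q 1 \<le> q' 0 + q' 1"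

text \<open>Given the centre \<open>u\<close>, the value \<open>f 0\<close> has weight
  \<open>q u / 4\<close>. A decreasing \<open>q\<close> moves weight to the larger value
  \<open>f 1\<close> as \<open>u\<close> grows.\<close>

lemma st_increasing_coin_centre:
  assumes k: "k \<in> {1, 2}" and q: "profile q" "antimono_on {0, 1, 2} q"
  shows "st_increasing (uniform_on cube) (coin k q) (\<lambda>\<omega>. \<omega> 0)"
proof (rule st_increasing_uniformI)
  fix f :: "real \<Rightarrow> real" and x y
  assume f: "mono f" and xy: "x \<in> cube" "y \<in> cube" "x 0 \<le> y 0"
  let ?a = "fibre_avg cube (\<lambda>\<omega>. \<omega> 0) (\<lambda>\<omega>. f (coin k q \<omega>))"
  have q4: "q u \<le> 4" for u using q by (simp add: profile_def)
  have *: "?a u = (real (q u) * f 0 + (4 - real (q u)) * f 1) / 4" if "u \<in> {0, 1, 2}" for u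
  proof -
    have "(\<Sum>\<omega>\<in>cube. if \<omega> 0 = u then f (coin k q \<omega>) else 0) =
        4 * (real (q u) * f 0 + (4 - real (q u)) * f 1)"
      by (subst sum_cube_coin[where f="\<lambda>x y. if x = u then f y else 0", OF k q4])
        (use that in \<open>auto simp: sum_lessThan_3\<close>)
    \<comment> \<open>One value of the centre leaves \<open>4 * 4 = 16\<close> outcomes of the
      dice.\<close>
    moreover have "(\<Sum>\<omega>\<in>cube. if \<omega> 0 = u then 1 else 0 :: real) = 16"
      using that by (auto simp: sum_cube sum_lessThan_3)
    ultimately show ?thesis by (simp add: fibre_avg_eq)
  qed
  have m: "x 0 \<in> {0, 1, 2}" "y 0 \<in> {0, 1, 2}" using xy cube_0 by blast+
  have "real (q (y 0)) \<le> real (q (x 0))"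
    using q(2) m xy(3) by (auto simp: monotone_on_def)
  moreover have "f 0 \<le> f 1" using f by (simp add: monoD)
  ultimately have "0 \<le> (real (q (x 0)) - real (q (y 0))) * (f 1 - f 0)" by simp
  then show "?a (x 0) \<le> ?a (y 0)"
    unfolding *[OF m(1)] *[OF m(2)] by (intro divide_right_mono) (simp_all add: algebra_simps)
qed auto

text \<open>The coin has only two values, so just two conditional means are compared, and partial
  sums of \<open>q\<close> suffice.\<close>

lemma st_increasing_centre_coin:
  assumes k: "k \<in> {1, 2}" and q: "profile q"
  shows "st_increasing (uniform_on cube) (\<lambda>\<omega>. \<omega> 0) (coin k q)"
proof (rule st_increasing_uniformI)
  fix f :: "real \<Rightarrow> real" and x y
  assume f: "mono f" and xy: "x \<in> cube" "y \<in> cube" "coin k q x \<le> coin k q y"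
  let ?a = "fibre_avg cube (coin k q) (\<lambda>\<omega>. f (\<omega> 0))"
  have q4: "q u \<le> 4" for u using q by (simp add: profile_def)
  have tot: "real (q 0) + real (q 1) + real (q 2) = 6" "2 \<le> real (q 0)" "4 \<le> real (q 0) + real (q 1)"
    using q unfolding profile_def by (simp_all flip: of_nat_add)
  have "(\<Sum>\<omega>\<in>cube. if coin k q \<omega> = 0 then f (\<omega> 0) else 0) =
      4 * (real (q 0) * f 0 + real (q 1) * f 1 + real (q 2) * f 2)"
    by (subst sum_cube_coin[where f="\<lambda>x y. if y = 0 then f x else 0", OF k q4])
      (simp add: sum_lessThan_3)
  \<comment> \<open>The total \<open>6\<close> of a profile makes the coin fair: each value occupies
    half of the \<open>48\<close> points.\<close>
  moreover have "(\<Sum>\<omega>\<in>cube. if coin k q \<omega> = 0 then 1 else 0 :: real) = 24"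
    by (subst sum_cube_coin[where f="\<lambda>x y. if y = 0 then 1 else 0", OF k q4])
      (use tot in \<open>simp add: sum_lessThan_3\<close>)
  moreover have "(\<Sum>\<omega>\<in>cube. if coin k q \<omega> = 1 then f (\<omega> 0) else 0) =
      4 * ((4 - real (q 0)) * f 0 + (4 - real (q 1)) * f 1 + (4 - real (q 2)) * f 2)"
    by (subst sum_cube_coin[where f="\<lambda>x y. if y = 1 then f x else 0", OF k q4])
      (simp add: sum_lessThan_3)
  moreover have "(\<Sum>\<omega>\<in>cube. if coin k q \<omega> = 1 then 1 else 0 :: real) = 24"
    by (subst sum_cube_coin[where f="\<lambda>x y. if y = 1 then 1 else 0", OF k q4])
      (use tot in \<open>simp add: sum_lessThan_3\<close>)
  ultimately have "?a 0 = (real (q 0) * f 0 + real (q 1) * f 1 + real (q 2) * f 2) / 6"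
    "?a 1 = ((4 - real (q 0)) * f 0 + (4 - real (q 1)) * f 1 + (4 - real (q 2)) * f 2) / 6"
    by (simp_all add: fibre_avg_eq)
  \<comment> \<open>Abel summation of \<open>3 * (?a 1 - ?a 0)\<close>; the coefficients are
    nonnegative by the two inequalities in \<open>profile\<close>.\<close>
  moreover have "0 \<le> (real (q 0) - 2) * (f 1 - f 0) + (real (q 0) + real (q 1) - 4) * (f 2 - f 1)"
    using f tot by (intro add_nonneg_nonneg mult_nonneg_nonneg) (auto simp: monoD)
  moreover have "real (q 2) * f 2 = (6 - real (q 0) - real (q 1)) * f 2"
    using tot(1) by (metis add.commute add_diff_cancel_left' diff_diff_eq)
  ultimately have "?a 0 \<le> ?a 1"
    by (simp add: algebra_simps divide_right_mono)
  then show "?a (coin k q x) \<le> ?a (coin k q y)"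
    using coin_cases[of k q x] coin_cases[of k q y] xy(3) by auto
qed auto

text \<open>Over a fixed value of the centre the sample points form the product of the two dice, and
  each of \<open>V\<close> and \<open>W\<close> looks at one die only.\<close>

lemma cond_indep_given_centre:
  assumes V: "\<And>x y. x \<in> cube \<Longrightarrow> y \<in> cube \<Longrightarrow> x 0 = y 0 \<Longrightarrow> x 1 = y 1 \<Longrightarrow> V x = V y"
    and W: "\<And>x y. x \<in> cube \<Longrightarrow> y \<in> cube \<Longrightarrow> x 0 = y 0 \<Longrightarrow> x 2 = y 2 \<Longrightarrow> W x = W y"
  shows "cond_indep_given (uniform_on cube) SA V SB W (\<lambda>\<omega>. \<omega> 0)"
    and "cond_indep_given (uniform_on cube) SB W SA V (\<lambda>\<omega>. \<omega> 0)"
proof -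
  let ?a = "fibre_avg cube (\<lambda>\<omega>. \<omega> 0)"
  have avg: "?a Z (real u) = (\<Sum>v<4. \<Sum>w<4. Z (point u v w)) / 16" if "u < 3" for Z u
  proof -
    have "(\<Sum>\<omega>\<in>cube. if \<omega> 0 = real u then Z \<omega> else 0) = (\<Sum>v<4. \<Sum>w<4. Z (point u v w))" for Z
      using that unfolding sum_cube
      by (subst sum.remove[of _ u]) (auto intro!: sum.neutral)
    moreover from this[of "\<lambda>_. 1 :: real"] have "(\<Sum>\<omega>\<in>cube. if \<omega> 0 = real u then 1 else 0 :: real) = 16"
      by simp
    ultimately show ?thesis by (simp add: fibre_avg_eq)
  qed
  have "?a (indicator {\<omega>. V \<omega> \<in> A \<and> W \<omega> \<in> B}) (\<omega> 0) =
      ?a (indicator {\<omega>. V \<omega> \<in> A}) (\<omega> 0) * ?a (indicator {\<omega>. W \<omega> \<in> B}) (\<omega> 0)"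
    if \<omega>: "\<omega> \<in> cube" for A B \<omega>
  proof -
    obtain u where u: "u < 3" "\<omega> 0 = real u" using \<omega> by (auto simp: cube_def)
    \<comment> \<open>The die that is irrelevant for the event is frozen at the arbitrary outcome
      \<open>0\<close>, so that the double sum factorises.\<close>
    define g where "g v = (indicator A (V (point u v 0)) :: real)" for v
    define h where "h w = (indicator B (W (point u 0 w)) :: real)" for w
    have "indicator {\<omega>. V \<omega> \<in> A} (point u v w) = g v" "indicator {\<omega>. W \<omega> \<in> B} (point u v w) = h w"
      if "v < 4" "w < 4" for v w
      using that u V[of "point u v w" "point u v 0"] W[of "point u v w" "point u 0 w"]
      by (auto simp: g_def h_def indicator_def)
    moreover from this have "indicator {\<omega>. V \<omega> \<in> A \<and> W \<omega> \<in> B} (point u v w) = g v * h w"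
      if "v < 4" "w < 4" for v w
      using that by (simp add: Collect_conj_eq indicator_inter_arith)
    ultimately show ?thesis
      unfolding u(2) avg[OF u(1)] by (simp add: sum_distrib_left[symmetric] sum_distrib_right[symmetric])
  qed
  then show "cond_indep_given (uniform_on cube) SA V SB W (\<lambda>\<omega>. \<omega> 0)"
    and "cond_indep_given (uniform_on cube) SB W SA V (\<lambda>\<omega>. \<omega> 0)"
    by (auto intro!: cond_indep_given_uniformI simp: conj_commute mult.commute)
qed

section \<open>Stochastic orders for coins\<close>

lemma subvec_space [simp]:
  "subvec X J \<omega> \<in> space (PiM J (\<lambda>_. borel))" "subvec X J \<in> UNIV \<rightarrow> space (PiM J (\<lambda>_. borel))"
  by (auto simp: subvec_def space_PiM)

lemma integral_law_uniform:
  assumes "finite S" "S \<noteq> {}" "h \<in> borel_measurable (PiM J (\<lambda>_. borel))"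
  shows "integrable (law (uniform_on S) X J) h"
    and "integral\<^sup>L (law (uniform_on S) X J) h = (\<Sum>\<omega>\<in>S. h (subvec X J \<omega>)) / card S"
proof -
  have "integrable (uniform_on S) (\<lambda>\<omega>. h (subvec X J \<omega>))"
    by (rule integrable_measure_pmf_finite) (use assms in simp)
  then show "integrable (law (uniform_on S) X J) h"
    unfolding law_def using assms(3) by (subst integrable_distr_eq) simp_all
  show "integral\<^sup>L (law (uniform_on S) X J) h = (\<Sum>\<omega>\<in>S. h (subvec X J \<omega>)) / card S"
    unfolding law_def using assms by (subst integral_distr) (simp_all add: integral_pmf_of_set)
qed

lemma law_cong:
  assumes "\<And>j. j \<in> J \<Longrightarrow> X j = Y j"
  shows "law M X J = law M Y J"
proof -
  have "subvec X J = subvec Y J" using assms by (auto simp: subvec_def fun_eq_iff restrict_def)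
  then show ?thesis by (simp add: law_def)
qed

lemma sm_le_uniform_refl:
  assumes "finite S" "S \<noteq> {}" "b \<in> borel_measurable (PiM J (\<lambda>_. borel))"
  shows "sm_le b J (law (uniform_on S) X J) (law (uniform_on S) X J)"
  using integral_law_uniform(1)[OF assms] by (simp add: sm_le_def)

lemma profile_total:
  assumes "profile q"
  shows "q u \<le> 4" "real (q 0) + real (q 1) + real (q 2) = 6" "2 \<le> real (q 0)"
    "4 \<le> real (q 0) + real (q 1)"
  using assms unfolding profile_def by (simp_all flip: of_nat_add)

text \<open>By supermodularity the increment of \<open>f\<close> in the coin is increasing in the centre, so
  Abel summation reduces the claim to the domination of partial sums.\<close>

lemma sm_le_coin:
  assumes ij: "i \<noteq> j" and k: "k \<in> {1, 2}" and q: "profile q" "profile q'" "dominated q q'"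
    and \<phi>: "mono \<phi>" and b: "b \<in> borel_measurable (PiM {i, j} (\<lambda>_. borel))"
    and X: "X i = (\<lambda>\<omega>. \<phi> (\<omega> 0))" "X j = coin k q"
    and Y: "Y i = (\<lambda>\<omega>. \<phi> (\<omega> 0))" "Y j = coin k q'"
  shows "sm_le b {i, j} (law (uniform_on cube) X {i, j}) (law (uniform_on cube) Y {i, j})"
  unfolding sm_le_def
proof (intro conjI ballI impI)
  show "integrable (law (uniform_on cube) X {i, j}) b" "integrable (law (uniform_on cube) Y {i, j}) b"
    by (simp_all add: integral_law_uniform(1)[OF _ _ b])
  fix f :: "(nat \<Rightarrow> real) \<Rightarrow> real"
  assume f: "f \<in> borel_measurable (PiM {i, j} (\<lambda>_. borel))" and sm: "supermodular {i, j} f"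
  define vec where "vec u v = (\<lambda>m\<in>{i, j}. if m = i then \<phi> u else v :: real)" for u :: real and v
  define F where "F u v = f (vec u v)" for u v
  define D where "D u = F u 0 - F u 1" for u
  have D: "D u' \<le> D u" if "u \<le> u'" for u u'
  proof -
    have "\<phi> u \<le> \<phi> u'" using \<phi> that by (rule monoD)
    then have "inf (vec u 1) (vec u' 0) = vec u 0" "sup (vec u 1) (vec u' 0) = vec u' 1"
      by (auto simp: vec_def fun_eq_iff inf_absorb1 sup_absorb2 inf_real_def sup_real_def)
    \<comment> \<open>Supermodularity for the crossed pair \<open>(u, 1)\<close>,
      \<open>(u', 0)\<close>; the meet and join are \<open>(u, 0)\<close> and
      \<open>(u', 1)\<close>, so \<open>D\<close>, the negative increment, decreases.\<close>
    moreover have "f (vec u 1) + f (vec u' 0) \<le> f (inf (vec u 1) (vec u' 0)) + f (sup (vec u 1) (vec u' 0))"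
      using sm unfolding supermodular_def by (auto simp: vec_def)
    ultimately show ?thesis by (simp add: D_def F_def)
  qed
  have "subvec X {i, j} \<omega> = vec (\<omega> 0) (coin k q \<omega>)" "subvec Y {i, j} \<omega> = vec (\<omega> 0) (coin k q' \<omega>)" for \<omega>
    using ij by (auto simp: subvec_def vec_def fun_eq_iff X Y)
  then have int: "integral\<^sup>L (law (uniform_on cube) X {i, j}) f = (\<Sum>\<omega>\<in>cube. F (\<omega> 0) (coin k q \<omega>)) / 48"
    "integral\<^sup>L (law (uniform_on cube) Y {i, j}) f = (\<Sum>\<omega>\<in>cube. F (\<omega> 0) (coin k q' \<omega>)) / 48"
    by (simp_all add: integral_law_uniform(2)[OF _ _ f] card_cube F_def)
  have sum: "(\<Sum>\<omega>\<in>cube. F (\<omega> 0) (coin k p \<omega>)) =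
      4 * (real (p 0) * D 0 + real (p 1) * D 1 + real (p 2) * D 2 + 4 * (F 0 1 + F 1 1 + F 2 1))"
    if "profile p" for p
    by (subst sum_cube_coin[where f=F, OF k profile_total(1)[OF that]])
      (simp add: sum_lessThan_3 D_def algebra_simps)
  note t = profile_total(2)[OF q(1)] profile_total(2)[OF q(2)]
  have "real (q 0) \<le> real (q' 0)" "real (q 0) + real (q 1) \<le> real (q' 0) + real (q' 1)"
    using q(3) unfolding dominated_def by (simp_all flip: of_nat_add)
  \<comment> \<open>The right-hand side is the difference of the two \<open>D\<close>-weighted sums;
    its boundary term vanishes because both totals are \<open>6\<close>.\<close>
  then have "0 \<le> (real (q' 0) - real (q 0)) * (D 0 - D 1) +
      (real (q' 0) + real (q' 1) - (real (q 0) + real (q 1))) * (D 1 - D 2)"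
    using D[of 0 1] D[of 1 2] by (intro add_nonneg_nonneg mult_nonneg_nonneg) simp_all
  moreover have "real (q 2) * D 2 = (6 - real (q 0) - real (q 1)) * D 2"
    "real (q' 2) * D 2 = (6 - real (q' 0) - real (q' 1)) * D 2"
    using t by simp_all
  ultimately have "real (q 0) * D 0 + real (q 1) * D 1 + real (q 2) * D 2 \<le>
      real (q' 0) * D 0 + real (q' 1) * D 1 + real (q' 2) * D 2"
    by (simp add: algebra_simps)
  then show "integral\<^sup>L (law (uniform_on cube) X {i, j}) f \<le> integral\<^sup>L (law (uniform_on cube) Y {i, j}) f"
    unfolding int sum[OF q(1)] sum[OF q(2)] by (intro divide_right_mono) simp_all
qed

lemma emeasure_distr_uniform:
  assumes "finite S" "S \<noteq> {}" "A \<in> sets borel"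
  shows "emeasure (distr (uniform_on S) borel U) A =
    ennreal ((\<Sum>\<omega>\<in>S. indicator A (U \<omega>)) / card S)"
proof -
  have "emeasure (distr (uniform_on S) borel U) A = ennreal (measure (uniform_on S) (U -` A))"
    using assms by (subst emeasure_distr) (simp_all add: measure_pmf.emeasure_eq_measure)
  also have "measure (uniform_on S) (U -` A) = card (S \<inter> U -` A) / card S"
    using assms by (simp add: measure_pmf_of_set)
  also have "real (card (S \<inter> U -` A)) = (\<Sum>\<omega>\<in>S. indicator A (U \<omega>))"
    using assms by (simp add: indicator_def sum.If_cases vimage_def Int_def)
  finally show ?thesis .
qed

text \<open>All profiles have the same total, so making the coin independent of the centre amounts to
  replacing its profile by the constant one.\<close>

lemma indep_law_coin:
  assumes ij: "i \<noteq> j" and k: "k \<in> {1, 2}" and q: "profile q"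
    and X: "X i = (\<lambda>\<omega>. \<omega> 0)" "X j = coin k q"
    and Y: "Y i = (\<lambda>\<omega>. \<omega> 0)" "Y j = coin k (\<lambda>_. 2)"
  shows "indep_law (uniform_on cube) X {i, j} = law (uniform_on cube) Y {i, j}"
proof -
  have vec: "subvec Y {i, j} \<omega> = (\<lambda>m\<in>{i, j}. if m = i then \<omega> 0 else coin k (\<lambda>_. 2) \<omega>)" for \<omega>
    using ij by (auto simp: subvec_def fun_eq_iff Y)
  have count: "real (card (cube \<inter> subvec Y {i, j} -` PiE {i, j} A)) =
      (\<Sum>\<omega>\<in>cube. indicator (A i) (\<omega> 0) * indicator (A j) (coin k (\<lambda>_. 2) \<omega>))" for A
  proof -
    have "(\<Sum>\<omega>\<in>cube. indicator (A i) (\<omega> 0) * indicator (A j) (coin k (\<lambda>_. 2) \<omega>)) =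
        (\<Sum>\<omega>\<in>cube. if \<omega> \<in> subvec Y {i, j} -` PiE {i, j} A then 1 else 0 :: real)"
      using ij by (intro sum.cong) (auto simp: vec PiE_iff indicator_def)
    then show ?thesis by (simp add: sum.If_cases Int_def)
  qed
  let ?\<mu> = "\<lambda>j. distr (uniform_on cube) borel (X j)"
  interpret prob_space "?\<mu> m" for m by (rule measure_pmf.prob_space_distr) simp
  interpret product_sigma_finite ?\<mu> by standard
  have "law (uniform_on cube) Y {i, j} = PiM {i, j} ?\<mu>"
  proof (rule PiM_eqI)
    show "sets (law (uniform_on cube) Y {i, j}) = sets (PiM {i, j} ?\<mu>)"
      unfolding law_def by (simp cong: sets_PiM_cong)
    fix A assume "\<And>m. m \<in> {i, j} \<Longrightarrow> A m \<in> sets (?\<mu> m)"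
    then have A: "A i \<in> sets borel" "A j \<in> sets borel" by auto
    have PA: "PiE {i, j} A \<in> sets (PiM {i, j} (\<lambda>_. borel))"
      using A by (intro sets_PiM_I_finite) auto
    have "emeasure (law (uniform_on cube) Y {i, j}) (PiE {i, j} A) =
        ennreal (measure (uniform_on cube) (subvec Y {i, j} -` PiE {i, j} A))"
      unfolding law_def using PA
      by (subst emeasure_distr) (simp_all add: measure_pmf.emeasure_eq_measure)
    also have "measure (uniform_on cube) (subvec Y {i, j} -` PiE {i, j} A) =
        card (cube \<inter> subvec Y {i, j} -` PiE {i, j} A) / 48"
      by (simp add: measure_pmf_of_set card_cube)
    \<comment> \<open>The factor \<open>8\<close> is \<open>4\<close> for the ignored die times the
      constant profile value \<open>2\<close>.\<close>
    also have "real (card (cube \<inter> subvec Y {i, j} -` PiE {i, j} A)) = 8 * (\<Sum>u<3. indicator (A i) (real u)) * (indicator (A j) 0 + indicator (A j) 1)"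
      unfolding count
      by (subst sum_cube_coin[where f="\<lambda>u v. indicator (A i) u * indicator (A j) v", OF k])
        (simp_all add: sum_lessThan_3 algebra_simps)
    finally have law: "emeasure (law (uniform_on cube) Y {i, j}) (PiE {i, j} A) =
      ennreal (8 * (\<Sum>u<3. indicator (A i) (real u)) * (indicator (A j) 0 + indicator (A j) 1) / 48)" .
    have "(\<Sum>\<omega>\<in>cube. indicator (A i) (\<omega> 0)) = 16 * (\<Sum>u<3. indicator (A i) (real u) :: real)"
      by (simp add: sum_cube sum_distrib_left)
    then have i: "emeasure (?\<mu> i) (A i) = ennreal ((\<Sum>u<3. indicator (A i) (real u)) / 3)"
      using A by (simp add: emeasure_distr_uniform X card_cube)
    have "(\<Sum>\<omega>\<in>cube. indicator (A j) (coin k q \<omega>)) =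
        4 * (6 * indicator (A j) 0 + 6 * indicator (A j) 1 :: real)"
      using profile_total(2)[OF q]
      by (subst sum_cube_coin[where f="\<lambda>u v. indicator (A j) v", OF k profile_total(1)[OF q]])
        (auto simp: sum_lessThan_3 indicator_def)
    then have j: "emeasure (?\<mu> j) (A j) = ennreal ((indicator (A j) 0 + indicator (A j) 1) / 2)"
      using A by (simp add: emeasure_distr_uniform X card_cube)
    show "emeasure (law (uniform_on cube) Y {i, j}) (PiE {i, j} A) = (\<Prod>m\<in>{i, j}. emeasure (?\<mu> m) (A m))"
      using ij unfolding law by (simp add: i j sum_nonneg flip: ennreal_mult)
  qed simp
  then show ?thesis by (simp add: indep_law_def)
qed

section \<open>Comparison with independence, and lower orthants\<close>

lemma dominated_const: "profile q \<Longrightarrow> dominated (\<lambda>_. 2) q"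
  by (auto simp: profile_def dominated_def)

lemma profile_const: "profile (\<lambda>_. 2)"
  by (simp add: profile_def)

lemma indep_sm_le_coin:
  assumes ij: "i \<noteq> j" and k: "k \<in> {1, 2}" and q: "profile q"
    and b: "b \<in> borel_measurable (PiM {i, j} (\<lambda>_. borel))"
    and X: "X i = (\<lambda>\<omega>. \<omega> 0)" "X j = coin k q"
  shows "sm_le b {i, j} (indep_law (uniform_on cube) X {i, j}) (law (uniform_on cube) X {i, j})"
proof -
  define Y where "Y m = (if m = i then (\<lambda>\<omega>. \<omega> 0) else coin k (\<lambda>_. 2))" for m :: nat
  have Y: "Y i = (\<lambda>\<omega>. \<omega> 0)" "Y j = coin k (\<lambda>_. 2)" using ij by (auto simp: Y_def)
  show ?thesis
    unfolding indep_law_coin[OF ij k q X Y]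
    by (rule sm_le_coin[OF ij k profile_const q dominated_const[OF q] _ b, where \<phi>="\<lambda>x. x"])
      (simp_all add: X Y mono_def)
qed

text \<open>The indicator of a lower orthant is supermodular: the meet lies in it if either point
  does, the join if both do. It is bounded by any weight because weights are at least
  \<open>1\<close>.\<close>

lemma sm_le_imp_lo_le:
  assumes J: "finite J" and S: "finite S" "S \<noteq> {}" and b: "weight J b"
    and le: "sm_le b J (law (uniform_on S) X J) (law (uniform_on S) Y J)"
  shows "lo_le J (law (uniform_on S) X J) (law (uniform_on S) Y J)"
  unfolding lo_le_def
proof
  fix t :: "nat \<Rightarrow> real"
  define A where "A = {x \<in> J \<rightarrow>\<^sub>E UNIV. \<forall>j\<in>J. x j \<le> t j}"
  let ?f = "indicator A :: (nat \<Rightarrow> real) \<Rightarrow> real"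
  have "A = PiE J (\<lambda>j. {..t j})" by (auto simp: A_def PiE_iff extensional_def)
  also have "\<dots> \<in> sets (PiM J (\<lambda>_. borel))" using J by (intro sets_PiM_I_finite) auto
  finally have A: "A \<in> sets (PiM J (\<lambda>_. borel))" .
  have "inf x y \<in> J \<rightarrow>\<^sub>E UNIV" "sup x y \<in> J \<rightarrow>\<^sub>E UNIV"
    if "x \<in> J \<rightarrow>\<^sub>E UNIV" "y \<in> J \<rightarrow>\<^sub>E UNIV" for x y :: "nat \<Rightarrow> real"
    using that by (auto simp: PiE_def extensional_def)
  then have "supermodular J ?f"
    unfolding supermodular_def by (auto simp: A_def indicator_def le_infI1 le_infI2)
  moreover have "bounded_by_weight J b ?f"
    unfolding bounded_by_weight_def
    using b by (intro exI[of _ 1]) (auto simp: weight_def indicator_def divide_le_eq_1)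
  ultimately have "integral\<^sup>L (law (uniform_on S) X J) ?f \<le> integral\<^sup>L (law (uniform_on S) Y J) ?f"
    using le A unfolding sm_le_def by auto
  moreover have "{x \<in> space (law (uniform_on S) Z J). \<forall>j\<in>J. x j \<le> t j} = A" for Z
    by (simp add: law_def A_def space_PiM)
  moreover have "A \<inter> (J \<rightarrow>\<^sub>E UNIV) = A" by (auto simp: A_def)
  ultimately show "measure (law (uniform_on S) X J) {x \<in> space (law (uniform_on S) X J). \<forall>j\<in>J. x j \<le> t j} \<le>
      measure (law (uniform_on S) Y J) {x \<in> space (law (uniform_on S) Y J). \<forall>j\<in>J. x j \<le> t j}"
    by (simp add: law_def space_PiM)
qed

section \<open>Coins on a tree\<close>

definition config ::
  "nat set \<Rightarrow> nat \<Rightarrow> nat \<Rightarrow> (real \<Rightarrow> nat) \<Rightarrow> (real \<Rightarrow> nat) \<Rightarrow> nat \<Rightarrow> (nat \<Rightarrow> real) \<Rightarrow> real" where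
  "config C a c q r n = (if n \<in> C then (\<lambda>\<omega>. \<omega> 0) else if n = a then coin 1 q
     else if n = c then coin 2 r else (\<lambda>_. 0))"

text \<open>By \<open>core\<close>, a node separating two random nodes carries the centre; by
  \<open>no_edge\<close>, every edge condition involves at most one coin.\<close>

locale coin_tree =
  fixes N :: "nat set" and E :: "(nat \<times> nat) set" and C :: "nat set" and a c :: nat
  assumes tree: "directed_tree N E"
    and nodes: "insert a (insert c C) \<subseteq> N"
    and distinct: "a \<noteq> c" "a \<notin> C" "c \<notin> C"
    and no_edge: "(a, c) \<notin> E" "(c, a) \<notin> E"
    and core: "\<And>x y. x \<in> insert a (insert c C) \<Longrightarrow> y \<in> insert a (insert c C) \<Longrightarrow>
      path_between E x y \<subseteq> C"
begin

lemma config_simps [simp]: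
  "n \<in> C \<Longrightarrow> config C a c q r n = (\<lambda>\<omega>. \<omega> 0)"
  "config C a c q r a = coin 1 q" "config C a c q r c = coin 2 r"
  "n \<notin> insert a (insert c C) \<Longrightarrow> config C a c q r n = (\<lambda>_. 0)"
  using distinct by (auto simp: config_def)

lemma subvec_cong:
  "(\<And>n. n \<in> A \<Longrightarrow> X n \<omega> = X n \<omega>') \<Longrightarrow> subvec X A \<omega> = subvec X A \<omega>'"
  by (auto simp: subvec_def)

lemma markov_config:
  "markov_tree_distributed N E (uniform_on cube) (config C a c q r)"
  unfolding markov_tree_distributed_def
proof (intro conjI ballI allI impI)
  fix n show "config C a c q r n \<in> borel_measurable (uniform_on cube)" by simp
next
  fix A B :: "nat set" and i
  assume AB: "A \<inter> B = {}" and sep: "separates E i A B"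
  let ?X = "config C a c q r" and ?S = "insert a (insert c C)"
  let ?indep = "cond_indep_given (uniform_on cube) (PiM A (\<lambda>_. borel)) (subvec ?X A)
      (PiM B (\<lambda>_. borel)) (subvec ?X B) (?X i)"
  show ?indep
  proof (cases "i \<in> C")
    case True
    then have i: "?X i = (\<lambda>\<omega>. \<omega> 0)" by simp
    \<comment> \<open>As \<open>A\<close> and \<open>B\<close> are disjoint, either one side
      contains no coin and is determined by the centre, or each side can only contain one of the two
      coins.\<close>
    consider "a \<notin> A" "c \<notin> A" | "a \<notin> B" "c \<notin> B" | "c \<notin> A" "a \<notin> B" | "a \<notin> A" "c \<notin> B"
      using AB by blast
    then show ?thesis
    proof cases
      case 1
      show ?thesis unfolding i
        by (rule cond_indep_given_determined(1))
          (use 1 in \<open>auto intro!: subvec_cong simp: config_def\<close>)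
    next
      case 2
      show ?thesis unfolding i
        by (rule cond_indep_given_determined(2))
          (use 2 in \<open>auto intro!: subvec_cong simp: config_def\<close>)
    next
      case 3
      show ?thesis unfolding i
        by (rule cond_indep_given_centre(1))
          (use 3 in \<open>auto intro!: subvec_cong simp: config_def coin_def\<close>)
    next
      case 4
      show ?thesis unfolding i
        by (rule cond_indep_given_centre(2))
          (use 4 in \<open>auto intro!: subvec_cong simp: config_def coin_def\<close>)
    qed
  next
    case False
    \<comment> \<open>A side without random nodes is constant. If both sides have one,
      \<open>core\<close> forces \<open>i \<in> C\<close>.\<close>
    consider "A \<inter> ?S = {}" | "B \<inter> ?S = {}" | x y where "x \<in> A" "x \<in> ?S" "y \<in> B" "y \<in> ?S"
      by blast
    then show ?thesis
    proof cases
      case 1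
      show ?thesis
        by (rule cond_indep_given_determined(1))
          (use 1 in \<open>auto intro!: subvec_cong simp: config_def\<close>)
    next
      case 2
      show ?thesis
        by (rule cond_indep_given_determined(2))
          (use 2 in \<open>auto intro!: subvec_cong simp: config_def\<close>)
    next
      case 3
      then have "i \<in> path_between E x y" using sep by (simp add: separates_def)
      then show ?thesis using core[OF 3(2,4)] False by blast
    qed
  qed
qed

text \<open>Only a coin conditioned on the centre needs a decreasing profile; the centre given a
  coin is covered by \<open>profile\<close> alone.\<close>

lemma st_increasing_config:
  assumes pr: "profile q" "profile r" and mn: "{m, n} \<noteq> {a, c}"
    and q: "m = a \<Longrightarrow> n \<in> C \<Longrightarrow> antimono_on {0, 1, 2} q"
    and r: "m = c \<Longrightarrow> n \<in> C \<Longrightarrow> antimono_on {0, 1, 2} r"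
  shows "st_increasing (uniform_on cube) (config C a c q r m) (config C a c q r n)"
proof -
  let ?S = "insert a (insert c C)"
  consider "m \<notin> ?S" | "n \<notin> ?S" | "m = n" | "m \<in> C" "n \<in> C" | "m \<in> C" "n = a" | "m \<in> C" "n = c" |
    "m = a" "n \<in> C" | "m = c" "n \<in> C" using mn by blast
  then show ?thesis
  proof cases
    case 1
    then show ?thesis by (intro st_increasing_determined) simp_all
  next
    case 2
    then show ?thesis by (intro st_increasing_const) simp_all
  next
    case 3
    then show ?thesis by (intro st_increasing_determined) simp_all
  next
    case 4
    then show ?thesis by (intro st_increasing_determined) simp_all
  next
    case 5
    then show ?thesis using st_increasing_centre_coin[OF _ pr(1), of 1] by simp
  next
    case 6
    then show ?thesis using st_increasing_centre_coin[OF _ pr(2), of 2] by simp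
  next
    case 7
    then show ?thesis using st_increasing_coin_centre[OF _ pr(1) q, of 1] by simp
  next
    case 8
    then show ?thesis using st_increasing_coin_centre[OF _ pr(2) r, of 2] by simp
  qed
qed

text \<open>The bound \<open>2\<close> is the largest value of the centre, so the orthant only
  restricts the coins, to \<open>0\<close>. Over the centre \<open>u\<close> this leaves
  \<open>q u * r u\<close> of the dice outcomes.\<close>

lemma orthant_config:
  assumes J: "finite J" "a \<in> J" "c \<in> J" and q: "\<And>u. q u \<le> 4" and r: "\<And>u. r u \<le> 4"
    and t: "t = (\<lambda>n. if n \<in> {a, c} then 0 else 2)"
  defines "\<mu> \<equiv> law (uniform_on cube) (config C a c q r) J"
  shows "measure \<mu> {x \<in> space \<mu>. \<forall>j\<in>J. x j \<le> t j} = (q 0 * r 0 + q 1 * r 1 + q 2 * r 2) / 48"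
proof -
  let ?X = "config C a c q r"
  define A where "A = PiE J (\<lambda>j. {..t j})"
  have A: "A \<in> sets (PiM J (\<lambda>_. borel))"
    unfolding A_def using J by (intro sets_PiM_I_finite) auto
  have sub: "A \<inter> space \<mu> = A"
    unfolding A_def \<mu>_def law_def by (auto simp: space_PiM PiE_iff)
  have "{x \<in> space \<mu>. \<forall>j\<in>J. x j \<le> t j} = A"
    unfolding A_def \<mu>_def law_def by (auto simp: space_PiM PiE_iff extensional_def)
  then have "measure \<mu> {x \<in> space \<mu>. \<forall>j\<in>J. x j \<le> t j} = integral\<^sup>L \<mu> (indicator A)"
    using sub by simp
  also have "\<dots> = (\<Sum>\<omega>\<in>cube. indicator A (subvec ?X J \<omega>)) / 48"
    unfolding \<mu>_def using A by (subst integral_law_uniform(2)) (simp_all add: card_cube)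
  also have "(\<Sum>\<omega>\<in>cube. indicator A (subvec ?X J \<omega>)) =
      (\<Sum>\<omega>\<in>cube. if coin 1 q \<omega> = 0 \<and> coin 2 r \<omega> = 0 then 1 else 0 :: real)"
  proof (rule sum.cong[OF refl])
    fix \<omega> assume "\<omega> \<in> cube"
    then have w: "\<omega> 0 \<le> 2" using cube_0[of \<omega>] by auto
    have "subvec ?X J \<omega> \<in> A \<longleftrightarrow> (\<forall>j\<in>J. ?X j \<omega> \<le> t j)"
      by (auto simp: A_def subvec_def PiE_iff)
    also have "\<dots> \<longleftrightarrow> coin 1 q \<omega> \<le> 0 \<and> coin 2 r \<omega> \<le> 0"
    proof
      assume "\<forall>j\<in>J. ?X j \<omega> \<le> t j"
      then show "coin 1 q \<omega> \<le> 0 \<and> coin 2 r \<omega> \<le> 0" using J t by (metis config_simps(2,3) insertI1 insertI2)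
    next
      assume "coin 1 q \<omega> \<le> 0 \<and> coin 2 r \<omega> \<le> 0"
      then show "\<forall>j\<in>J. ?X j \<omega> \<le> t j" using w distinct by (auto simp: t config_def)
    qed
    also have "\<dots> \<longleftrightarrow> coin 1 q \<omega> = 0 \<and> coin 2 r \<omega> = 0"
      using coin_cases[of 1 q \<omega>] coin_cases[of 2 r \<omega>] by auto
    finally show "indicator A (subvec ?X J \<omega>) = (if coin 1 q \<omega> = 0 \<and> coin 2 r \<omega> = 0 then 1 else 0 :: real)"
      by (simp add: indicator_def)
  qed
  also have "\<dots> = (\<Sum>u<3. real (q (real u)) * real (r (real u)))"
    unfolding sum_cube
  proof (rule sum.cong[OF refl])
    fix u :: nat
    let ?g = "\<lambda>x. if x = 0 then 1 else 0 :: real"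
    have "(\<Sum>v<4. \<Sum>w<4. if coin 1 q (point u v w) = 0 \<and> coin 2 r (point u v w) = 0 then 1 else 0 :: real) =
        (\<Sum>v<4. \<Sum>w<4. ?g (if real v < real (q (real u)) then 0 else 1 :: real) *
           ?g (if real w < real (r (real u)) then 0 else 1 :: real))"
      by (intro sum.cong) (auto simp: coin_def)
    also have "\<dots> = real (q (real u)) * real (r (real u))"
      unfolding sum_product[symmetric] sum_die[OF q, of ?g] sum_die[OF r, of ?g] by simp
    finally show "(\<Sum>v<4. \<Sum>w<4. if coin 1 q (point u v w) = 0 \<and> coin 2 r (point u v w) = 0 then 1 else 0 :: real)
        = real (q (real u)) * real (r (real u))" .
  qed
  finally show ?thesis by (simp add: sum_lessThan_3)
qed

lemma config_counterexample:
  fixes b :: "nat set \<Rightarrow> (nat \<Rightarrow> real) \<Rightarrow> real"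
  assumes weight: "\<And>J. finite J \<Longrightarrow> J \<subseteq> N \<Longrightarrow> weight J (b J)"
    and pr: "profile q" "profile r" "profile q'" "profile r'"
    and dom: "dominated q q'" "dominated r r'"
    and less: "q' 0 * r' 0 + q' 1 * r' 1 + q' 2 * r' 2 < q 0 * r 0 + q 1 * r 1 + q 2 * r 2"
  defines "M \<equiv> uniform_on cube" and "X \<equiv> config C a c q r" and "Y \<equiv> config C a c q' r'"
  shows "prob_space M" "markov_tree_distributed N E M X" "markov_tree_distributed N E M Y"
    "weight_integrable b N M X" "weight_integrable b N M Y"
    "\<not> seq_lo_le N M X Y" "\<not> seq_sm_le b N M X Y" "\<forall>e\<in>E. cond_iii b M X Y e"
proof -
  have meas: "b J \<in> borel_measurable (PiM J (\<lambda>_. borel))" if "finite J" "J \<subseteq> N" for J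
    using weight[OF that] by (simp add: weight_def)
  show "prob_space M" unfolding M_def by (rule measure_pmf.prob_space_axioms)
  show "markov_tree_distributed N E M X" "markov_tree_distributed N E M Y"
    unfolding M_def X_def Y_def by (rule markov_config)+
  show "weight_integrable b N M X" "weight_integrable b N M Y"
    unfolding M_def weight_integrable_def by (simp_all add: integral_law_uniform(1) meas)
  \<comment> \<open>A finite family is compared only as a whole, while for an infinite one the two
    coins already suffice.\<close>
  define J where "J = (if finite N then N else {a, c})"
  have J: "J \<in> compared_sets N" "finite J" "J \<subseteq> N" "a \<in> J" "c \<in> J"
    using nodes by (auto simp: J_def compared_sets_def)
  have lo: "\<not> lo_le J (law M X J) (law M Y J)"
  proof
    assume "lo_le J (law M X J) (law M Y J)"
    from this[unfolded lo_le_def, rule_format, of "\<lambda>n. if n \<in> {a, c} then 0 else 2"]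
    have "real (q 0 * r 0 + q 1 * r 1 + q 2 * r 2) / 48 \<le>
        real (q' 0 * r' 0 + q' 1 * r' 1 + q' 2 * r' 2) / 48"
      unfolding M_def X_def Y_def
      by (subst (asm) (1 2) orthant_config[OF J(2,4,5) _ _ refl]) (simp_all add: pr profile_total(1))
    then show False using less by (simp del: of_nat_add of_nat_mult)
  qed
  then show "\<not> seq_lo_le N M X Y" using J(1) by (auto simp: seq_lo_le_def)
  show "\<not> seq_sm_le b N M X Y"
    using lo J(1) sm_le_imp_lo_le[OF J(2) finite_cube cube_nonempty weight[OF J(2,3)]]
    unfolding seq_sm_le_def M_def by blast
  have leaf: "sm_le (b {i, j}) {i, j} (law M X {i, j}) (law M Y {i, j})"
    if ij: "i \<in> N" "j \<in> {a, c}" "i \<notin> {a, c}" for i j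
  proof -
    \<comment> \<open>The neighbour of a coin is the centre or the constant \<open>0\<close>; both
      are monotone images of the centre, so \<open>sm_le_coin\<close> treats them together.\<close>
    define \<phi> :: "real \<Rightarrow> real" where "\<phi> x = (if i \<in> C then x else 0)" for x
    have \<phi>: "mono \<phi>" by (auto simp: mono_def \<phi>_def)
    have i: "X i = (\<lambda>\<omega>. \<phi> (\<omega> 0))" "Y i = (\<lambda>\<omega>. \<phi> (\<omega> 0))"
      using ij by (auto simp: X_def Y_def config_def \<phi>_def fun_eq_iff)
    have ne: "i \<noteq> j" using ij by blast
    have b: "b {i, j} \<in> borel_measurable (PiM {i, j} (\<lambda>_. borel))"
      using meas ij nodes by auto
    show ?thesis
    proof (cases "j = a")
      case True
      then have "X j = coin 1 q" "Y j = coin 1 q'" by (simp_all add: X_def Y_def)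
      then show ?thesis unfolding M_def using ij
        by (intro sm_le_coin[where k=1 and q=q and q'=q' and \<phi>=\<phi>]) (simp_all add: ne pr dom \<phi> b i)
    next
      case False
      then have "X j = coin 2 r" "Y j = coin 2 r'" using ij by (auto simp: X_def Y_def)
      then show ?thesis unfolding M_def using ij
        by (intro sm_le_coin[where k=2 and q=r and q'=r' and \<phi>=\<phi>]) (simp_all add: ne pr dom \<phi> b i)
    qed
  qed
  show "\<forall>e\<in>E. cond_iii b M X Y e"
  proof (intro ballI)
    fix e assume "e \<in> E"
    moreover obtain i j where e: "e = (i, j)" by (cases e)
    ultimately have ij: "(i, j) \<in> E" by simp
    then have n: "i \<in> N" "j \<in> N" "i \<noteq> j"
      using edge_nodes[OF tree] tree_acyclic[OF tree, of i] by auto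
    \<comment> \<open>At most one end of an edge is a coin. Without a coin the pair does not depend
      on the profiles.\<close>
    have "\<not> (i \<in> {a, c} \<and> j \<in> {a, c})" using ij no_edge n(3) by auto
    then consider "j \<in> {a, c}" "i \<notin> {a, c}" | "i \<in> {a, c}" "j \<notin> {a, c}" | "i \<notin> {a, c}" "j \<notin> {a, c}"
      by blast
    then have "sm_le (b {i, j}) {i, j} (law M X {i, j}) (law M Y {i, j})"
    proof cases
      case 1
      then show ?thesis using leaf n by blast
    next
      case 2
      then show ?thesis using leaf[OF n(2), of i] by (simp add: insert_commute)
    next
      case 3
      then have "law M X {i, j} = law M Y {i, j}"
        by (intro law_cong) (auto simp: X_def Y_def config_def)
      then show ?thesis
        using sm_le_uniform_refl[OF finite_cube cube_nonempty meas[of "{i, j}"], of X] n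
        by (simp add: M_def)
    qed
    then show "cond_iii b M X Y e" by (simp add: cond_iii_def e)
  qed
qed

section \<open>Reducing the edge conditions to edges between a coin and the centre\<close>

lemma cond_i_config:
  assumes e: "e \<in> E" and pr: "profile q" "profile r"
    and q: "\<And>i. (i, a) \<in> E \<Longrightarrow> i \<in> C \<Longrightarrow> a \<in> K \<or> antimono_on {0, 1, 2} q"
    and r: "\<And>i. (i, c) \<in> E \<Longrightarrow> i \<in> C \<Longrightarrow> c \<in> K \<or> antimono_on {0, 1, 2} r"
  shows "cond_i (uniform_on cube) (config C a c q r) K e"
proof -
  obtain i j where ij: "e = (i, j)" by (cases e)
  then have "{j, i} \<noteq> {a, c}" using e no_edge by (auto simp: doubleton_eq_iff)
  then show ?thesis
    unfolding cond_i_def ij using e ij q r by (auto intro!: st_increasing_config[OF pr])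
qed

text \<open>A coin is conditioned on the centre either as a child of a node of \<open>C\<close>,
  where \<open>K'\<close> may exempt it, or as the parent of a node \<open>j\<close> of
  \<open>C\<close>, where \<open>K\<close> may exempt \<open>j\<close>.\<close>

lemma cond_ii_config:
  assumes e: "e \<in> E" and pr: "profile q" "profile r"
    and q: "\<And>i. (i, a) \<in> E \<Longrightarrow> i \<in> C \<Longrightarrow> a \<in> K' \<or> antimono_on {0, 1, 2} q"
      "\<And>j. (a, j) \<in> E \<Longrightarrow> j \<in> C \<Longrightarrow> j \<in> K \<or> antimono_on {0, 1, 2} q"
    and r: "\<And>i. (i, c) \<in> E \<Longrightarrow> i \<in> C \<Longrightarrow> c \<in> K' \<or> antimono_on {0, 1, 2} r"
      "\<And>j. (c, j) \<in> E \<Longrightarrow> j \<in> C \<Longrightarrow> j \<in> K \<or> antimono_on {0, 1, 2} r"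
  shows "cond_ii (uniform_on cube) (config C a c q r) K K' e"
proof -
  obtain i j where ij: "e = (i, j)" by (cases e)
  then have "{j, i} \<noteq> {a, c}" "{i, j} \<noteq> {a, c}" using e no_edge by (auto simp: doubleton_eq_iff)
  then show ?thesis
    unfolding cond_ii_def ij using e ij q r by (auto intro!: st_increasing_config[OF pr])
qed

lemma indep_sm_le_config:
  assumes weight: "\<And>J. finite J \<Longrightarrow> J \<subseteq> N \<Longrightarrow> weight J (b J)" and q: "profile q" and m: "m \<in> C"
  shows "indep_sm_le b (uniform_on cube) (config C a c q r) m a"
    and "indep_sm_le b (uniform_on cube) (config C a c q r) a m"
proof -
  have "b {m, a} \<in> borel_measurable (PiM {m, a} (\<lambda>_. borel))"
    using weight[of "{m, a}"] m nodes by (auto simp: weight_def)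
  moreover have "m \<noteq> a" using m distinct by auto
  ultimately show "indep_sm_le b (uniform_on cube) (config C a c q r) m a"
    unfolding indep_sm_le_def using q m by (intro indep_sm_le_coin[where k=1 and q=q]) simp_all
  then show "indep_sm_le b (uniform_on cube) (config C a c q r) a m"
    unfolding indep_sm_le_def by (simp add: insert_commute)
qed

end

text \<open>With a top node \<open>r\<close>, closure under parents below it and at most one
  neighbour in \<open>C\<close> for each coin, \<open>path_between_core\<close> supplies
  \<open>core\<close>.\<close>

lemma coin_treeI:
  assumes tree: "directed_tree N E" and nodes: "insert a (insert c C) \<subseteq> N"
    and distinct: "a \<noteq> c" "a \<notin> C" "c \<notin> C"
    and no_edge: "(a, c) \<notin> E" "(c, a) \<notin> E"
    and top: "insert a (insert c C) \<subseteq> E\<^sup>* `` {r}"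
      "\<And>s u. s \<in> insert a (insert c C) \<Longrightarrow> s \<noteq> r \<Longrightarrow> (u, s) \<in> E \<Longrightarrow> u \<in> insert a (insert c C)"
    and one: "\<And>u v. u \<in> C \<Longrightarrow> v \<in> C \<Longrightarrow> (u, a) \<in> E \<or> (a, u) \<in> E \<Longrightarrow> (v, a) \<in> E \<or> (a, v) \<in> E \<Longrightarrow> u = v"
      "\<And>u v. u \<in> C \<Longrightarrow> v \<in> C \<Longrightarrow> (u, c) \<in> E \<or> (c, u) \<in> E \<Longrightarrow> (v, c) \<in> E \<or> (c, v) \<in> E \<Longrightarrow> u = v"
  shows "coin_tree N E C a c"
proof
  fix x y assume xy: "x \<in> insert a (insert c C)" "y \<in> insert a (insert c C)"
  have loop: "(s, s) \<notin> E" for s using tree_acyclic[OF tree, of s] by auto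
  show "path_between E x y \<subseteq> C"
  proof (rule path_between_core[OF tree refl top _ xy])
    fix s u v assume *: "s \<in> {a, c}" "u \<in> insert a (insert c C)" "v \<in> insert a (insert c C)"
      "(u, s) \<in> E \<or> (s, u) \<in> E" "(v, s) \<in> E \<or> (s, v) \<in> E"
    then have "u \<in> C" "v \<in> C" using loop[of a] loop[of c] no_edge by auto
    then show "u = v" using * one by blast
  qed
qed (use assms in blast)+

lemma coin_tree_single:
  assumes "directed_tree N E" "insert a (insert c {m}) \<subseteq> N" "a \<noteq> c" "a \<noteq> m" "c \<noteq> m"
    "(a, c) \<notin> E" "(c, a) \<notin> E" "insert a (insert c {m}) \<subseteq> E\<^sup>* `` {r}"
    "\<And>s u. s \<in> insert a (insert c {m}) \<Longrightarrow> s \<noteq> r \<Longrightarrow> (u, s) \<in> E \<Longrightarrow> u \<in> insert a (insert c {m})"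
  shows "coin_tree N E {m} a c"
  by (rule coin_treeI[where r=r]) (use assms in simp_all)

section \<open>Three-valued profiles\<close>

lemma profile_triple:
  "profile (triple x y z) \<longleftrightarrow> x \<le> 4 \<and> y \<le> 4 \<and> z \<le> 4 \<and> 2 \<le> x \<and> 4 \<le> x + y \<and> x + y + z = 6"
proof -
  have "(\<forall>u. triple x y z u \<le> 4) \<longleftrightarrow> x \<le> 4 \<and> y \<le> 4 \<and> z \<le> 4"
  proof
    assume *: "\<forall>u. triple x y z u \<le> 4"
    from *[rule_format, of 0] *[rule_format, of 1] *[rule_format, of 2]
    show "x \<le> 4 \<and> y \<le> 4 \<and> z \<le> 4" by (simp add: triple_def)
  qed (simp add: triple_def)
  then show ?thesis by (simp add: profile_def triple_def conj_assoc)
qed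

lemma dominated_triple:
  "dominated (triple x y z) (triple x' y' z') \<longleftrightarrow> x \<le> x' \<and> x + y \<le> x' + y'"
  by (simp add: dominated_def triple_def)

lemma antimono_triple: "z \<le> y \<Longrightarrow> y \<le> x \<Longrightarrow> antimono_on {0, 1, 2} (triple x y z)"
  by (auto simp: monotone_on_def triple_def)

lemma triple_simps [simp]: "triple x y z 0 = x" "triple x y z 1 = y" "triple x y z 2 = z"
  by (simp_all add: triple_def)

section \<open>Parents, leaves and the branching of a maximal path\<close>

context
  fixes N :: "nat set" and E :: "(nat \<times> nat) set"
  assumes tree: "directed_tree N E"
begin

lemma has_parent:
  assumes "i \<in> N" "i \<noteq> 0"
  obtains p where "(p, i) \<in> E"
  using root_reaches[OF tree assms(1)] assms(2) by (metis rtranclE)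

lemma no_loop: "(i, i) \<notin> E"
  using tree_acyclic[OF tree, of i] by auto

lemma no_2cycle: "(i, j) \<in> E \<Longrightarrow> (j, i) \<notin> E"
  using tree_acyclic[OF tree, of i] by (meson trancl.intros)

lemma no_cycle_above: "(i, j) \<in> E\<^sup>* \<Longrightarrow> (j, i) \<notin> E"
  using tree_acyclic[OF tree, of i] by (meson rtrancl_into_trancl1)

lemma nonleaf_has_child:
  assumes "j \<in> N" "j \<noteq> 0" "j \<notin> leaves N E"
  obtains d where "(j, d) \<in> E"
proof (rule ccontr)
  assume "\<not> thesis"
  then have none: "(j, d) \<notin> E" for d using that by blast
  obtain p where p: "(p, j) \<in> E" using has_parent assms by blast
  have "i = p" if "(i, j) \<in> E" for i by (rule parent_unique[OF tree that p])
  then have "{i. (j, i) \<in> E \<or> (i, j) \<in> E} = {p}" using none p by blast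
  then have "deg E j = 1" by (simp add: deg_def ecard_def one_enat_def)
  then show False using assms by (simp add: leaves_def)
qed

lemma leaf_no_child:
  assumes "j \<in> leaves N E"
  shows "(j, d) \<notin> E"
proof
  assume d: "(j, d) \<in> E"
  have j: "j \<in> N" "j \<noteq> 0" "deg E j = 1" using assms by (auto simp: leaves_def)
  obtain p where p: "(p, j) \<in> E" using has_parent j by blast
  let ?A = "{i. (j, i) \<in> E \<or> (i, j) \<in> E}"
  have "finite ?A" "card ?A = 1"
    using j(3) by (auto simp: deg_def ecard_def one_enat_def split: if_splits)
  then obtain x where "?A = {x}" by (auto simp: card_1_singleton_iff)
  moreover have "p \<in> ?A" "d \<in> ?A" using p d by simp_all
  ultimately have "p = d" by (metis singletonD)
  then show False using p d no_2cycle by blast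
qed

lemma path_walk:
  assumes "path_from_root E n l" "enat k \<le> n"
  shows "\<exists>w. directed_walk E 0 (l k) w \<and> length w = Suc k"
  using assms(2)
proof (induction k)
  case 0
  have "directed_walk E 0 (l 0) [0]"
    using assms(1) by (simp add: directed_walk_def path_from_root_def)
  then show ?case by (intro exI[of _ "[0]"]) simp
next
  case (Suc k)
  have "enat k \<le> n" using Suc.prems by (meson Suc_ile_eq less_imp_le)
  then obtain w where w: "directed_walk E 0 (l k) w" "length w = Suc k" using Suc.IH by blast
  have "(l k, l (Suc k)) \<in> E"
    using assms(1) Suc.prems by (simp add: path_from_root_def Suc_ile_eq)
  then show ?case using walk_snoc[OF w(1)] w(2) by (intro exI[of _ "w @ [l (Suc k)]"]) simp
qed

text \<open>The path cannot stay among \<open>p\<close> and its ancestors: a final leaf has no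
  child, whereas these nodes do, and an infinite path would give arbitrarily long walks to
  \<open>j\<close>. The branch point \<open>m\<close> is the last node before it leaves
  them.\<close>

lemma maximal_path_branches:
  assumes P: "maximal_path N E P" and p: "(p, j) \<in> E" and j: "j \<notin> P"
  obtains m d where "(m, p) \<in> E\<^sup>*" "(d, p) \<notin> E\<^sup>*" "(m, d) \<in> E" "d \<in> P"
proof -
  obtain n l where n: "1 \<le> n" and l: "path_from_root E n l"
    and Pl: "P = {l k |k. 1 \<le> k \<and> enat k \<le> n}" and leaf: "\<And>m. n = enat m \<Longrightarrow> l m \<in> leaves N E"
    using P unfolding maximal_path_def by blast
  have pj: "p \<in> N" "j \<in> N" "j \<noteq> 0"
    using edge_nodes[OF tree p] edge_target_not_root[OF tree p] by auto
  have "\<exists>k. enat k \<le> n \<and> (l k, p) \<notin> E\<^sup>*"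
  proof (rule ccontr)
    assume "\<not> ?thesis"
    then have above: "(l k, p) \<in> E\<^sup>*" if "enat k \<le> n" for k using that by blast
    show False
    proof (cases n)
      case (enat m)
      then have "l m = p \<or> (\<exists>d. (l m, d) \<in> E)" using above[of m] by (metis converse_rtranclE order_refl)
      then show False using p leaf_no_child[OF leaf[OF enat]] by blast
    next
      case infinity
      \<comment> \<open>Following the path for \<open>length w\<close> edges already uses one node
        more than the walk \<open>w\<close>.\<close>
      obtain w where w: "directed_walk E 0 j w" using walk_from_root[OF tree pj(2)] by blast
      obtain v where v: "directed_walk E 0 (l (length w)) v" "length v = Suc (length w)"
        using path_walk[OF l, of "length w"] infinity by auto
      have "(l (length w), j) \<in> E\<^sup>*" using above[of "length w"] infinity p by simp
      then obtain u where "directed_walk E 0 j (v @ u)" using walk_extend[OF v(1)] by blast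
      then have "w = v @ u" using walk_unique[OF tree pj(2,3) w] by blast
      then show False using v(2) by simp
    qed
  qed
  then have ex: "\<exists>k. enat k \<le> n \<and> (l k, p) \<notin> E\<^sup>*" .
  \<comment> \<open>By minimality the preceding node reaches \<open>p\<close>. The index is positive
    since the root reaches \<open>p\<close>, so \<open>l k\<close> belongs to \<open>P\<close>,
    which omits the root.\<close>
  define k where "k = (LEAST k. enat k \<le> n \<and> (l k, p) \<notin> E\<^sup>*)"
  have k: "enat k \<le> n" "(l k, p) \<notin> E\<^sup>*" using LeastI_ex[OF ex] by (simp_all add: k_def)
  have "l 0 = 0" using l by (simp add: path_from_root_def)
  then have "k \<noteq> 0" using k(2) root_reaches[OF tree pj(1)] by metis
  then obtain k' where k': "k = Suc k'" using not0_implies_Suc by blast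
  then have lt: "enat k' < n" using k(1) by (simp add: Suc_ile_eq)
  have "(l k', p) \<in> E\<^sup>*"
    using not_less_Least[of k' "\<lambda>k. enat k \<le> n \<and> (l k, p) \<notin> E\<^sup>*"] lt k' by (auto simp: k_def)
  moreover have "(l k', l k) \<in> E" using l lt k' by (simp add: path_from_root_def)
  moreover have "l k \<in> P" using k(1) \<open>k \<noteq> 0\<close> Pl by force
  ultimately show thesis using that k(2) by blast
qed

end

text \<open>\<open>R\<close> and \<open>R'\<close> abstract from the monotonicity conditions, so
  that the three claims share one choice of witnesses.\<close>

lemma (in coin_tree) exists_counterexample:
  fixes b :: "nat set \<Rightarrow> (nat \<Rightarrow> real) \<Rightarrow> real"
  assumes weight: "\<And>J. finite J \<Longrightarrow> J \<subseteq> N \<Longrightarrow> weight J (b J)"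
    and "profile q" "profile r" "profile q'" "profile r'" "dominated q q'" "dominated r r'"
    and "q' 0 * r' 0 + q' 1 * r' 1 + q' 2 * r' 2 < q 0 * r 0 + q 1 * r 1 + q 2 * r 2"
    and R: "\<And>e. e \<in> E \<Longrightarrow> R (uniform_on cube) (config C a c q r) (config C a c q' r') e"
    and R': "\<And>e. e \<in> E \<Longrightarrow> R' (uniform_on cube) (config C a c q r) (config C a c q' r') e"
  shows "\<exists>(M :: (nat \<Rightarrow> real) measure) X Y. prob_space M \<and>
        markov_tree_distributed N E M X \<and> markov_tree_distributed N E M Y \<and>
        weight_integrable b N M X \<and> weight_integrable b N M Y \<and>
        \<not> seq_lo_le N M X Y \<and> \<not> seq_sm_le b N M X Y \<and>
        (\<forall>e\<in>E. R M X Y e \<and> R' M X Y e \<and> cond_iii b M X Y e)"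
  using config_counterexample[OF assms(1-8)] R R' by blast

theorem propositionA2:
  fixes N P L :: "nat set" and E :: "(nat \<times> nat) set" and k\<^sub>s :: nat
    and b :: "nat set \<Rightarrow> (nat \<Rightarrow> real) \<Rightarrow> real"
  assumes tree: "directed_tree N E"
    and size: "ecard N \<ge> 3"
    and L_def: "L = leaves N E"
    and path: "maximal_path N E P"
    and k_child: "(0, k\<^sub>s) \<in> E"
    and k_notin: "deg E 0 \<ge> 2 \<Longrightarrow> k\<^sub>s \<notin> P"
    and weight: "\<And>J. finite J \<Longrightarrow> J \<subseteq> N \<Longrightarrow> weight J (b J)"
  shows
    "(\<forall>j\<^sub>s \<in> N - {0, k\<^sub>s}. \<exists>(M :: (nat \<Rightarrow> real) measure) X Y. prob_space M \<and>
        markov_tree_distributed N E M X \<and> markov_tree_distributed N E M Y \<and>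
        weight_integrable b N M X \<and> weight_integrable b N M Y \<and>
        \<not> seq_lo_le N M X Y \<and> \<not> seq_sm_le b N M X Y \<and>
        (\<forall>e\<in>E. (cond_i M X {k\<^sub>s, j\<^sub>s} e \<and> indep_sm_le b M X (parent E j\<^sub>s) j\<^sub>s) \<and>
               cond_ii M Y L P e \<and>
               cond_iii b M X Y e)) \<and>
     (\<not> is_star N E \<longrightarrow>
      (\<forall>j\<^sub>s \<in> N - (L \<union> {0}). \<exists>(M :: (nat \<Rightarrow> real) measure) X Y. prob_space M \<and>
        markov_tree_distributed N E M X \<and> markov_tree_distributed N E M Y \<and>
        weight_integrable b N M X \<and> weight_integrable b N M Y \<and>
        \<not> seq_lo_le N M X Y \<and> \<not> seq_sm_le b N M X Y \<and>
        (\<forall>e\<in>E. cond_i M X {k\<^sub>s} e \<and>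
               (cond_ii M Y (L \<union> {j\<^sub>s}) P e \<and> indep_sm_le b M X (parent E j\<^sub>s) j\<^sub>s) \<and>
               cond_iii b M X Y e))) \<and>
     (\<not> is_chain N E \<longrightarrow>
      (\<forall>j\<^sub>s \<in> N - (P \<union> {0}). \<exists>(M :: (nat \<Rightarrow> real) measure) X Y. prob_space M \<and>
        markov_tree_distributed N E M X \<and> markov_tree_distributed N E M Y \<and>
        weight_integrable b N M X \<and> weight_integrable b N M Y \<and>
        \<not> seq_lo_le N M X Y \<and> \<not> seq_sm_le b N M X Y \<and>
        (\<forall>e\<in>E. cond_i M X {k\<^sub>s} e \<and>
               (cond_ii M Y L (P \<union> {j\<^sub>s}) e \<and> indep_sm_le b M X (parent E j\<^sub>s) j\<^sub>s) \<and>
               cond_iii b M X Y e)))"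
proof (intro conjI impI ballI)
  note unique = parent_unique[OF tree] and loop = no_loop[OF tree] and cycle = no_2cycle[OF tree]
  {
    fix j assume j: "j \<in> N - {0, k\<^sub>s}"
    then obtain p where p: "(p, j) \<in> E" using has_parent[OF tree] by blast
    note jp = parent_eq[OF tree p]
    have pj: "i = p" if "(i, j) \<in> E" for i using unique[OF that p] .
    \<comment> \<open>The second coin sits on another neighbour of \<open>p\<close>. Either it is
      exempt from (i), being \<open>k\<^sub>s\<close>, or it is no child of \<open>p\<close>, so the
      non-monotone profile of \<open>X\<close> violates nothing.\<close>
    obtain c where c: "coin_tree N E {p} j c" "c = k\<^sub>s \<or> (p, c) \<notin> E"
    proof (cases "p = 0")
      case True
      have k0: "k\<^sub>s \<noteq> 0" using edge_target_not_root[OF tree k_child] .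
      have pk: "i = 0" if "(i, k\<^sub>s) \<in> E" for i using unique[OF that k_child] .
      have "coin_tree N E {p} j k\<^sub>s"
      proof (rule coin_tree_single[where r=0, OF tree])
        show "(j, k\<^sub>s) \<notin> E" "(k\<^sub>s, j) \<notin> E"
          using pj[of k\<^sub>s] pk[of j] j True k0 by auto
        show "insert j (insert k\<^sub>s {p}) \<subseteq> N" using edge_nodes[OF tree] p k_child by blast
        then show "insert j (insert k\<^sub>s {p}) \<subseteq> E\<^sup>* `` {0}" using root_reaches[OF tree] by blast
        show "u \<in> insert j (insert k\<^sub>s {p})"
          if "s \<in> insert j (insert k\<^sub>s {p})" "s \<noteq> 0" "(u, s) \<in> E" for s u
          using that True by (auto dest: pj pk)
      qed (use j True k0 in auto)
      then show thesis using that by blast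
    next
      case False
      then obtain q where q: "(q, p) \<in> E" using has_parent[OF tree] edge_nodes[OF tree p] by blast
      have qp: "i = q" if "(i, p) \<in> E" for i using unique[OF that q] .
      have "coin_tree N E {p} j q"
      proof (rule coin_tree_single[where r=q, OF tree])
        show "(j, q) \<notin> E"
          using p q no_cycle_above[OF tree, of q j] by (meson r_into_rtrancl rtrancl_into_rtrancl)
        show "(q, j) \<notin> E" using pj[of q] q loop by auto
        show "insert j (insert q {p}) \<subseteq> N" using edge_nodes[OF tree] p q by blast
        show "insert j (insert q {p}) \<subseteq> E\<^sup>* `` {q}"
          using p q by (auto intro: rtrancl_into_rtrancl)
        show "u \<in> insert j (insert q {p})"
          if "s \<in> insert j (insert q {p})" "s \<noteq> q" "(u, s) \<in> E" for s u
          using that by (auto dest: pj qp)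
      qed (use p q loop cycle in blast)+
      then show thesis using that cycle[OF q] by blast
    qed
    then interpret coin_tree N E "{p}" j c by simp
    show "\<exists>(M :: (nat \<Rightarrow> real) measure) X Y. prob_space M \<and>
        markov_tree_distributed N E M X \<and> markov_tree_distributed N E M Y \<and>
        weight_integrable b N M X \<and> weight_integrable b N M Y \<and>
        \<not> seq_lo_le N M X Y \<and> \<not> seq_sm_le b N M X Y \<and>
        (\<forall>e\<in>E. (cond_i M X {k\<^sub>s, j} e \<and> indep_sm_le b M X (parent E j) j) \<and>
               cond_ii M Y L P e \<and> cond_iii b M X Y e)"
    \<comment> \<open>The products sum to \<open>16 + 0 + 4 = 20\<close> for \<open>X\<close> and
      \<open>16 + 1 + 1 = 18\<close> for \<open>Y\<close>, whose decreasing profiles satisfy (ii)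
      everywhere.\<close>
    proof (rule exists_counterexample[where q="triple 4 0 2" and r="triple 4 0 2" and
          q'="triple 4 1 1" and r'="triple 4 1 1" and R'="\<lambda>M X Y e. cond_ii M Y L P e" and
          R="\<lambda>M X Y e. cond_i M X {k\<^sub>s, j} e \<and> indep_sm_le b M X (parent E j) j", OF weight])
      fix e assume e: "e \<in> E"
      show "cond_i (uniform_on cube) (config {p} j c (triple 4 0 2) (triple 4 0 2)) {k\<^sub>s, j} e \<and>
          indep_sm_le b (uniform_on cube) (config {p} j c (triple 4 0 2) (triple 4 0 2)) (parent E j) j"
        unfolding jp
        by (intro conjI cond_i_config[OF e] indep_sm_le_config(1)[OF weight])
          (use c(2) in \<open>auto simp: profile_triple\<close>)
      show "cond_ii (uniform_on cube) (config {p} j c (triple 4 1 1) (triple 4 1 1)) L P e"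
        by (rule cond_ii_config[OF e]) (simp_all add: profile_triple antimono_triple)
    qed (simp_all add: profile_triple dominated_triple)
  next
    fix j assume j: "j \<in> N - (L \<union> {0})"
    obtain p where p: "(p, j) \<in> E" using j has_parent[OF tree] by blast
    obtain d where d: "(j, d) \<in> E" using j nonleaf_has_child[OF tree] L_def by blast
    note jp = parent_eq[OF tree p]
    have pj: "i = p" if "(i, j) \<in> E" for i using unique[OF that p] .
    have jd: "i = j" if "(i, d) \<in> E" for i using unique[OF that d] .
    have "coin_tree N E {j} p d"
    proof (rule coin_tree_single[where r=p, OF tree])
      show "(d, p) \<notin> E"
        using p d no_cycle_above[OF tree, of p d] by (meson r_into_rtrancl rtrancl_into_rtrancl)
      show "(p, d) \<notin> E" using jd[of p] p loop by auto
      show "insert p (insert d {j}) \<subseteq> N" using edge_nodes[OF tree] p d by blast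
      show "insert p (insert d {j}) \<subseteq> E\<^sup>* `` {p}"
        using p d by (auto intro: rtrancl_into_rtrancl)
      show "u \<in> insert p (insert d {j})"
        if "s \<in> insert p (insert d {j})" "s \<noteq> p" "(u, s) \<in> E" for s u
        using that by (auto dest: pj jd)
    qed (use p d loop cycle in blast)+
    then interpret coin_tree N E "{j}" p d .
    show "\<exists>(M :: (nat \<Rightarrow> real) measure) X Y. prob_space M \<and>
        markov_tree_distributed N E M X \<and> markov_tree_distributed N E M Y \<and>
        weight_integrable b N M X \<and> weight_integrable b N M Y \<and>
        \<not> seq_lo_le N M X Y \<and> \<not> seq_sm_le b N M X Y \<and>
        (\<forall>e\<in>E. cond_i M X {k\<^sub>s} e \<and>
          (cond_ii M Y (L \<union> {j}) P e \<and> indep_sm_le b M X (parent E j) j) \<and> cond_iii b M X Y e)"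
    \<comment> \<open>The profile \<open>(4,0,2)\<close> sits above \<open>j\<close>, so it is
      conditioned on the centre only where \<open>j\<close> is exempt. At \<open>d\<close>, a unit
      moves from level \<open>2\<close> to level \<open>1\<close>, where \<open>(4,0,2)\<close>
      vanishes: \<open>18\<close> drops to \<open>16\<close>.\<close>
    proof (rule exists_counterexample[where q="triple 4 0 2" and r="triple 4 1 1" and
          q'="triple 4 0 2" and r'="triple 4 2 0" and R="\<lambda>M X Y e. cond_i M X {k\<^sub>s} e" and
          R'="\<lambda>M X Y e. cond_ii M Y (L \<union> {j}) P e \<and> indep_sm_le b M X (parent E j) j", OF weight])
      fix e assume e: "e \<in> E"
      have jp': "(j, p) \<notin> E" using cycle[OF p] .
      show "cond_i (uniform_on cube) (config {j} p d (triple 4 0 2) (triple 4 1 1)) {k\<^sub>s} e"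
        by (rule cond_i_config[OF e]) (use jp' in \<open>auto simp: profile_triple antimono_triple\<close>)
      show "cond_ii (uniform_on cube) (config {j} p d (triple 4 0 2) (triple 4 2 0)) (L \<union> {j}) P e \<and>
          indep_sm_le b (uniform_on cube) (config {j} p d (triple 4 0 2) (triple 4 1 1)) (parent E j) j"
        unfolding jp
        by (intro conjI cond_ii_config[OF e] indep_sm_le_config(2)[OF weight])
          (use jp' in \<open>auto simp: profile_triple antimono_triple\<close>)
    qed (simp_all add: profile_triple dominated_triple)
  next
    fix j assume j: "j \<in> N - (P \<union> {0})"
    obtain p where p: "(p, j) \<in> E" using j has_parent[OF tree] by blast
    note jp = parent_eq[OF tree p]
    have pj: "i = p" if "(i, j) \<in> E" for i using unique[OF that p] .
    obtain m d where d: "(m, p) \<in> E\<^sup>*" "(d, p) \<notin> E\<^sup>*" "(m, d) \<in> E" "d \<in> P"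
      using maximal_path_branches[OF tree path p] j by blast
    have dm: "i = m" if "(i, d) \<in> E" for i using unique[OF that d(3)] .
    \<comment> \<open>All nodes from the root down to \<open>p\<close> copy the centre, which
      therefore is available both at the parent of \<open>j\<close> and at the branch point
      \<open>m\<close>.\<close>
    define C where "C = {i. (i, p) \<in> E\<^sup>*}"
    have up: "u \<in> C" if "(u, i) \<in> E" "i \<in> C" for u i
      using that by (auto simp: C_def intro: converse_rtrancl_into_rtrancl)
    have pC: "p \<in> C" "m \<in> C" and dC: "d \<notin> C" using d by (auto simp: C_def)
    have jC: "j \<notin> C" using no_cycle_above[OF tree, of j p] p by (auto simp: C_def)
    have aC: "(j, i) \<notin> E" "(d, i) \<notin> E" if "i \<in> C" for i
      using up that jC dC by blast+
    have "coin_tree N E C j d"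
    proof (rule coin_treeI[where r=0, OF tree])
      show "(j, d) \<notin> E" using dm[of j] pC jC by auto
      show "(d, j) \<notin> E" using pj[of d] pC dC by auto
      have "C \<subseteq> N"
      proof
        fix i assume "i \<in> C"
        then have "(i, p) \<in> E\<^sup>*" by (simp add: C_def)
        then show "i \<in> N"
          using edge_nodes[OF tree] edge_nodes[OF tree p] by (cases rule: converse_rtranclE) blast+
      qed
      then show "insert j (insert d C) \<subseteq> N" using edge_nodes[OF tree d(3)] j by blast
      then show "insert j (insert d C) \<subseteq> E\<^sup>* `` {0}" using root_reaches[OF tree] by blast
      show "u \<in> insert j (insert d C)"
        if "s \<in> insert j (insert d C)" "s \<noteq> 0" "(u, s) \<in> E" for s u
        using that pC by (auto dest: pj dm up)
      show "u = v" if "u \<in> C" "v \<in> C" "(u, j) \<in> E \<or> (j, u) \<in> E" "(v, j) \<in> E \<or> (j, v) \<in> E" for u v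
        using that aC(1) by (auto dest: pj)
      show "u = v" if "u \<in> C" "v \<in> C" "(u, d) \<in> E \<or> (d, u) \<in> E" "(v, d) \<in> E \<or> (d, v) \<in> E" for u v
        using that aC(2) by (auto dest: dm)
    qed (use d(4) j jC dC in auto)
    then interpret coin_tree N E C j d .
    show "\<exists>(M :: (nat \<Rightarrow> real) measure) X Y. prob_space M \<and>
        markov_tree_distributed N E M X \<and> markov_tree_distributed N E M Y \<and>
        weight_integrable b N M X \<and> weight_integrable b N M Y \<and>
        \<not> seq_lo_le N M X Y \<and> \<not> seq_sm_le b N M X Y \<and>
        (\<forall>e\<in>E. cond_i M X {k\<^sub>s} e \<and>
          (cond_ii M Y L (P \<union> {j}) e \<and> indep_sm_le b M X (parent E j) j) \<and> cond_iii b M X Y e)"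
    \<comment> \<open>For \<open>X\<close> both coins are independent of the centre, with sum
      \<open>12\<close>; for \<open>Y\<close> it is \<open>8\<close>. Both non-monotone profiles are
      exempt from (ii), at \<open>j\<close> by choice and at \<open>d\<close> because
      \<open>d \<in> P\<close>.\<close>
    proof (rule exists_counterexample[where q="triple 2 2 2" and r="triple 2 2 2" and
          q'="triple 4 0 2" and r'="triple 2 4 0" and R="\<lambda>M X Y e. cond_i M X {k\<^sub>s} e" and
          R'="\<lambda>M X Y e. cond_ii M Y L (P \<union> {j}) e \<and> indep_sm_le b M X (parent E j) j", OF weight])
      fix e assume e: "e \<in> E"
      show "cond_i (uniform_on cube) (config C j d (triple 2 2 2) (triple 2 2 2)) {k\<^sub>s} e"
        by (rule cond_i_config[OF e]) (simp_all add: profile_triple antimono_triple)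
      show "cond_ii (uniform_on cube) (config C j d (triple 4 0 2) (triple 2 4 0)) L (P \<union> {j}) e \<and>
          indep_sm_le b (uniform_on cube) (config C j d (triple 2 2 2) (triple 2 2 2)) (parent E j) j"
        unfolding jp
        by (intro conjI cond_ii_config[OF e] indep_sm_le_config(1)[OF weight])
          (use aC d(4) pC in \<open>auto simp: profile_triple\<close>)
    qed (simp_all add: profile_triple dominated_triple)
  }
qed

end
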